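(* Let $\{S_{U_1\dots U_n}\}_{n\ge1}$ be a sequence of Steiner symmetrizations on $\mathbb R^d$ along independently distributed random directions $\{U_i\}$ in $\mathbb S^{d-1}$. (a) If $$\sum_{i=1}^\infty P\bigl(d(U_i,v_i)<\rho\bigr)=\infty$$ for every radius $\rho>0$ and every sequence $\{v_i\}$ in $\mathbb S^{d-1}$, then $$P\left(\lim_{n\to\infty}\|S_{U_1\dots U_n}f-f^*\|_\infty=0\quad\forall f\in\mathcal C_c^+(\mathbb R^d)\right)=1 .$$ (b) The same conclusion holds if, instead, the random directions $\{U_i\}$ are identically distributed according to a probability measure $\mu$ on $\mathbb S^{d-1}$ whose support contains a generating set of directions for $O(d)$.
   Context: $\mathcal C_c^+(\mathbb R^d)$ is the space of nonnegative continuous compactly supported functions on $\mathbb R^d$; $m$ is Lebesgue measure; $d(u,v)$ for $u,v\in\mathbb S^{d-1}$ is the geodesic (angular) distance on the sphere. For $A\subset\mathbb R^d$ of finite volume, $A^*$ is the open ball centered at the origin with $m(A^* )=m(A)$; for nonnegative measurable $f$ vanishing weakly at infinity (all level sets $\{f>t\}$, $t>0$, have finite volume), $f^*$ is the lower semicontinuous radially decreasing function with $\{f^*>t\}=\{f>t\}^*$ for all $t>0$ (symmetric decreasing rearrangement). For $u\in\mathbb S^{d-1}$, the Steiner symmetrization $S_uf$ replaces the restriction of $f$ to each line $\{\xi+tu:t\in\mathbb R\}$, $\xi\perp u$, by its one-dimensional symmetric decreasing rearrangement (as a function of $t$). Set $S_{u_1\dots u_n}=S_{u_n}\circ\dots\circ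 S_{u_1}$. $P$ is the product measure determined by the distributions (Borel probability measures on $\mathbb S^{d-1}$) of the independent $U_i$. For $u\in\mathbb S^{d-1}$, $\sigma_u$ is the reflection of $\mathbb R^d$ at the hyperplane $u^\perp$. A set $G\subset\mathbb S^{d-1}$ is a generating set of directions for $O(d)$ if the finite products $\{\sigma_{u_n}\cdots\sigma_{u_1}:n\ge0,\ u_1,\dots,u_n\in G\}$ are dense in $O(d)$. The support of $\mu$ is the smallest closed set of full measure. *)

theory Defs
  imports "HOL-Probability.Probability"
begin

section \<open>Symmetric decreasing rearrangement\<close>

text \<open>The open centred ball with the Lebesgue measure of \<open>A\<close>; meaningful for
  \<open>A\<close> of finite volume (see \<open>in_sym_ball_iff\<close> below).\<close>

definition sym_ball :: "'a::euclidean_space set \<Rightarrow> 'a set" where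
  "sym_ball A = ball 0 (THE r. 0 \<le> r \<and> measure lebesgue (ball (0::'a) r) = measure lebesgue A)"

text \<open>For nonnegative functions vanishing weakly at infinity, \<open>f\<^sup>*\<close> is characterized by
  \<open>{f\<^sup>* > t} = {f > t}\<^sup>*\<close> for all \<open>t > 0\<close>. Its value at \<open>x\<close> is therefore the supremum of the
  levels \<open>t\<close> with \<open>x \<in> {f > t}\<^sup>*\<close> (and 0 if there are none). Since values are real, this is
  meaningful for bounded \<open>f\<close>; lemma \<open>superlevel_rearrangement\<close> below confirms the
  characterization.\<close>

definition rearrangement :: "('a::euclidean_space \<Rightarrow> real) \<Rightarrow> 'a \<Rightarrow> real" where
  "rearrangement f x = Sup (insert 0 {t. 0 < t \<and> x \<in> sym_ball {y. t < f y}})"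

lemma measure_lebesgue_ball0:
  assumes "0 \<le> r"
  shows "measure lebesgue (ball (0::'a::euclidean_space) r) = unit_ball_vol (DIM('a)) * r ^ DIM('a)"
  using assms by (simp add: content_ball measure_completion)

lemma sym_ball_radius:
  fixes A :: "'a::euclidean_space set"
  defines "r \<equiv> (THE r. 0 \<le> r \<and> measure lebesgue (ball (0::'a) r) = measure lebesgue A)"
  shows "0 \<le> r" "unit_ball_vol (DIM('a)) * r ^ DIM('a) = measure lebesgue A"
proof -
  define s where "s = root DIM('a) (measure lebesgue A / unit_ball_vol (DIM('a)))"
  have c: "unit_ball_vol (DIM('a)) > 0" by simp
  have s0: "0 \<le> s" using c by (simp add: s_def)
  have sp: "s ^ DIM('a) = measure lebesgue A / unit_ball_vol (DIM('a))"
    unfolding s_def using c by (intro real_root_pow_pos2) auto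
  have s: "0 \<le> s \<and> measure lebesgue (ball (0::'a) s) = measure lebesgue A"
    using s0 sp less_imp_neq[OF c] by (simp add: content_ball)
  have uniq: "t = s" if "0 \<le> t \<and> measure lebesgue (ball (0::'a) t) = measure lebesgue A" for t
  proof -
    have "t ^ DIM('a) = s ^ DIM('a)"
      using that s s0 c measure_lebesgue_ball0[of t, where 'a='a]
        measure_lebesgue_ball0[of s, where 'a='a] by (metis less_irrefl mult_cancel_left)
    then show ?thesis using that s0 by (meson DIM_positive power_eq_iff_eq_base)
  qed
  have "r = s" unfolding r_def using s uniq by (rule the_equality)
  then show "0 \<le> r" "unit_ball_vol (DIM('a)) * r ^ DIM('a) = measure lebesgue A"
    using s0 sp c by (auto simp: field_simps)
qed

lemma measure_sym_ball: "measure lebesgue (sym_ball A) = measure lebesgue A"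
  unfolding sym_ball_def using sym_ball_radius[of A]
  by (subst measure_lebesgue_ball0) simp_all

lemma in_sym_ball_iff:
  fixes x :: "'a::euclidean_space"
  shows "x \<in> sym_ball A \<longleftrightarrow> unit_ball_vol (DIM('a)) * norm x ^ DIM('a) < measure lebesgue A"
proof -
  define r where "r = (THE r. 0 \<le> r \<and> measure lebesgue (ball (0::'a) r) = measure lebesgue A)"
  have r: "0 \<le> r" "unit_ball_vol (DIM('a)) * r ^ DIM('a) = measure lebesgue A"
    unfolding r_def using sym_ball_radius[of A] by auto
  have "x \<in> sym_ball A \<longleftrightarrow> norm x < r" by (simp add: sym_ball_def r_def)
  also have "\<dots> \<longleftrightarrow> norm x ^ DIM('a) < r ^ DIM('a)"
    using r(1) power_mono_iff[of r "norm x" "DIM('a)"] by (simp add: not_le[symmetric])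
  also have "\<dots> \<longleftrightarrow> unit_ball_vol (DIM('a)) * norm x ^ DIM('a) < unit_ball_vol (DIM('a)) * r ^ DIM('a)"
    by simp
  finally show ?thesis using r(2) by simp
qed

lemma superlevel_rearrangement:
  fixes f :: "'a::euclidean_space \<Rightarrow> real"
  assumes meas: "f \<in> borel_measurable lebesgue"
    and fin: "\<And>t. 0 < t \<Longrightarrow> emeasure lebesgue {x. t < f x} < \<infinity>"
    and bdd: "\<And>x. f x \<le> B"
    and t: "0 < t"
  shows "{x. t < rearrangement f x} = sym_ball {x. t < f x}"
proof -
  have sets: "{x. s < f x} \<in> sets lebesgue" for s
    using meas by (auto simp: borel_measurable_iff_greater)
  have lm: "{x. s < f x} \<in> lmeasurable" if "0 < s" for s
    using sets fin[OF that] by (auto simp: fmeasurable_def)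
  have mono: "x \<in> sym_ball {y. a < f y}" if "a \<le> b" "0 < a" "x \<in> sym_ball {y. b < f y}" for a b x
  proof -
    have "measure lebesgue {y. b < f y} \<le> measure lebesgue {y. a < f y}"
      using that lm[OF \<open>0 < a\<close>] sets by (intro measure_mono_fmeasurable) auto
    then show ?thesis using that(3) unfolding in_sym_ball_iff by linarith
  qed
  have bd: "s \<le> B" if "x \<in> sym_ball {y. s < f y}" for s and x :: 'a
  proof (rule ccontr)
    assume "\<not> s \<le> B"
    then have "{y. s < f y} = {}" using bdd by (force simp: not_less intro: order_trans)
    with that have "unit_ball_vol (DIM('a)) * norm x ^ DIM('a) < 0"
      by (simp only: in_sym_ball_iff measure_empty)
    moreover have "0 \<le> unit_ball_vol (DIM('a)) * norm x ^ DIM('a)" by simp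
    ultimately show False by linarith
  qed
  have bda: "bdd_above (insert 0 {s. 0 < s \<and> x \<in> sym_ball {y. s < f y}})" for x
    using bd by (auto intro: bdd_aboveI[of _ B])
  have "t < rearrangement f x \<longleftrightarrow> (\<exists>s>t. x \<in> sym_ball {y. s < f y})" for x
    unfolding rearrangement_def using bda[of x] t
    by (subst less_cSup_iff) (auto intro: less_trans)
  also have "(\<exists>s>t. x \<in> sym_ball {y. s < f y}) \<longleftrightarrow> x \<in> sym_ball {y. t < f y}" for x
  proof
    assume "\<exists>s>t. x \<in> sym_ball {y. s < f y}"
    then show "x \<in> sym_ball {y. t < f y}" using mono t by (meson less_imp_le)
  next
    assume x: "x \<in> sym_ball {y. t < f y}"
    define A where "A n = {y. t + inverse (real (Suc n)) < f y}" for n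
    have U: "(\<Union>n. A n) = {y. t < f y}"
    proof
      show "(\<Union>n. A n) \<subseteq> {y. t < f y}"
      proof
        fix y assume "y \<in> (\<Union>n. A n)"
        then obtain n where "t + inverse (real (Suc n)) < f y" by (auto simp: A_def)
        moreover have "0 < inverse (real (Suc n))" by simp
        ultimately show "y \<in> {y. t < f y}" unfolding mem_Collect_eq by linarith
      qed
      show "{y. t < f y} \<subseteq> (\<Union>n. A n)"
      proof
        fix y assume "y \<in> {y. t < f y}"
        then obtain n where "inverse (real (Suc n)) < f y - t"
          using reals_Archimedean[of "f y - t"] by auto
        then show "y \<in> (\<Union>n. A n)" by (auto simp: A_def intro!: exI[of _ n])
      qed
    qed
    have "(\<lambda>n. measure lebesgue (A n)) \<longlonglongrightarrow> measure lebesgue (\<Union>n. A n)"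
    proof (rule Lim_measure_incseq)
      show "range A \<subseteq> sets lebesgue" using sets by (auto simp: A_def)
      show "incseq A"
      proof (rule monoI)
        fix m n :: nat assume "m \<le> n"
        then have "inverse (real (Suc n)) \<le> inverse (real (Suc m))"
          by (intro le_imp_inverse_le) auto
        then show "A m \<le> A n" unfolding A_def by (intro Collect_mono impI) linarith
      qed
      show "emeasure lebesgue (\<Union>n. A n) \<noteq> \<infinity>" using fin[OF t] U by auto
    qed
    then have "\<forall>\<^sub>F n in sequentially. unit_ball_vol (DIM('a)) * norm x ^ DIM('a) < measure lebesgue (A n)"
      using x unfolding U in_sym_ball_iff by (rule order_tendstoD)
    then obtain n where "unit_ball_vol (DIM('a)) * norm x ^ DIM('a) < measure lebesgue (A n)"
      using eventually_happens by fastforce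
    then show "\<exists>s>t. x \<in> sym_ball {y. s < f y}"
      unfolding A_def in_sym_ball_iff[symmetric]
      by (intro exI[of _ "t + inverse (real (Suc n))"]) simp
  qed
  finally show ?thesis by auto
qed


section \<open>Steiner symmetrization\<close>

text \<open>For a unit vector \<open>u\<close>: writing \<open>x = \<xi> + t *\<^sub>R u\<close> with \<open>\<xi>\<close> orthogonal to \<open>u\<close>, we have
  \<open>t = x \<bullet> u\<close> and \<open>\<xi> = x - (x \<bullet> u) *\<^sub>R u\<close>.\<close>

definition steiner :: "real^'d \<Rightarrow> (real^'d \<Rightarrow> real) \<Rightarrow> real^'d \<Rightarrow> real" where
  "steiner u f x = rearrangement (\<lambda>t. f (x - (x \<bullet> u) *\<^sub>R u + t *\<^sub>R u)) (x \<bullet> u)"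

text \<open>Directions are indexed from 0, so \<open>steiner_seq u n\<close> applies \<open>u 0\<close> first and
  \<open>u (n - 1)\<close> last.\<close>

primrec steiner_seq :: "(nat \<Rightarrow> real^'d) \<Rightarrow> nat \<Rightarrow> (real^'d \<Rightarrow> real) \<Rightarrow> real^'d \<Rightarrow> real" where
  "steiner_seq u 0 f = f"
| "steiner_seq u (Suc n) f = steiner (u n) (steiner_seq u n f)"

definition Cc_nonneg :: "(real^'d \<Rightarrow> real) set" where
  "Cc_nonneg = {f. continuous_on UNIV f \<and> (\<forall>x. 0 \<le> f x) \<and> compact (closure {x. f x \<noteq> 0})}"

definition sup_norm :: "(real^'d \<Rightarrow> real) \<Rightarrow> real" where
  "sup_norm g = (SUP x. \<bar>g x\<bar>)"


section \<open>Directions\<close>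

definition geo_dist :: "real^'d \<Rightarrow> real^'d \<Rightarrow> real" where
  "geo_dist u v = arccos (u \<bullet> v)"

definition sphere_borel :: "(real^'d) measure" where
  "sphere_borel = restrict_space borel (sphere 0 1)"

text \<open>For a Borel measure on the sphere the intersection below has full measure itself, as the
  sphere is second countable; it is the smallest closed set of full measure.\<close>

definition measure_support :: "(real^'d) measure \<Rightarrow> (real^'d) set" where
  "measure_support \<mu> = \<Inter>{C \<in> sets \<mu>. closed C \<and> emeasure \<mu> C = emeasure \<mu> (space \<mu>)}"

text \<open>The reflection at the hyperplane orthogonal to the unit vector \<open>u\<close>.\<close>

definition reflection :: "real^'d \<Rightarrow> real^'d \<Rightarrow> real^'d" where
  "reflection u x = x - (2 * (x \<bullet> u)) *\<^sub>R u"

definition reflection_products :: "(real^'d) set \<Rightarrow> (real^'d^'d) set" where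
  "reflection_products G =
     {foldr (\<lambda>u Q. matrix (reflection u) ** Q) us (mat 1) | us. set us \<subseteq> G}"

definition generating_directions :: "(real^'d) set \<Rightarrow> bool" where
  "generating_directions G \<longleftrightarrow>
     G \<subseteq> sphere 0 1 \<and> closure (reflection_products G) = {Q. orthogonal_matrix Q}"

end

theory Submission
  imports Defs "HOL-Complex_Analysis.Great_Picard"
begin

text \<open>Let \<open>moment g\<close> be the integral of \<open>\<bar>x\<bar>\<^sup>2 g x\<close>. A Steiner symmetrization never increases it, and
  preserves it only if it fixes \<open>g\<close>. All iterated symmetrizations of \<open>f\<close> lie in a set \<open>K\<close> of
  functions with the support radius, the moduli of continuity and the rearrangement of \<open>f\<close>, which is
  compact by the Arzela-Ascoli theorem. A minimizer of the moment on \<open>K\<close> is fixed by all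
  symmetrizations, hence it is \<open>f\<^sup>*\<close>; likewise \<open>f\<^sup>*\<close> is the only element of \<open>K\<close> fixed by all
  symmetrizations along a generating set. By compactness there are then \<open>\<delta>, \<rho> > 0\<close> and finitely many
  directions such that every \<open>g\<close> in \<open>K\<close> at distance at least \<open>\<epsilon>\<close> from \<open>f\<^sup>*\<close> loses at least \<open>\<delta>\<close> of its
  moment under all symmetrizations along directions within \<open>\<rho>\<close> of one of the chosen ones. The total loss
  is bounded by \<open>moment f\<close>, while by independence step \<open>n\<close> contributes an expected loss of at least
  \<open>\<delta>\<close> times the probability of hitting such a direction times the probability of still being
  \<open>\<epsilon>\<close>-far from \<open>f\<^sup>*\<close>. The hitting probabilities have infinite sum and the distance to \<open>f\<^sup>*\<close> is
  nonincreasing, so the probability of staying \<open>\<epsilon>\<close>-far forever is zero.\<close>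

section \<open>Steiner symmetrization of continuous functions\<close>

text \<open>The directions that lower the moment of the current function depend on that function,
  hence on the past, whereas the hypotheses only speak about directions fixed in advance. This is
  why the gap must be uniform over a finite set \<open>T\<close>: whichever element of
  \<open>T\<close> is useful at step \<open>n\<close>, the chance of hitting its neighbourhood is at
  least the minimum of the hitting probabilities over \<open>T\<close>, a deterministic number. In
  (a) the minimum is attained at some \<open>v n\<close> in \<open>T\<close>, and divergence is
  assumed for exactly such sequences \<open>v\<close>. In (b) the minimum is one positive constant,
  because the points of \<open>T\<close> lie in the support of \<open>\<mu>\<close>. A second
  obstacle is that the exceptional null set must serve all \<open>f\<close> at once. Symmetrization
  and rearrangement are both nonexpansive in the supremum norm, so convergence for a countable dense
  family implies it for every \<open>f\<close>; the same reduction makes the event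
  measurable.\<close>

text \<open>The analogue of \<^const>\<open>Cc_nonneg\<close> over an arbitrary Euclidean space, so that it also applies to
  restrictions to lines.\<close>
definition cc :: "('a::euclidean_space \<Rightarrow> real) set" where
  "cc = {f. continuous_on UNIV f \<and> (\<forall>x. 0 \<le> f x) \<and> (\<exists>R. \<forall>x. f x \<noteq> 0 \<longrightarrow> norm x \<le> R)}"

lemma cc_nonneg: "f \<in> cc \<Longrightarrow> 0 \<le> f x"
  and cc_continuous: "f \<in> cc \<Longrightarrow> continuous_on UNIV f"
  by (simp_all add: cc_def)

lemma cc_supportE:
  assumes "f \<in> cc" obtains R where "0 \<le> R" "\<And>x. f x \<noteq> 0 \<Longrightarrow> norm x \<le> R"
proof -
  obtain R where "\<forall>x. f x \<noteq> 0 \<longrightarrow> norm x \<le> R" using assms by (auto simp: cc_def)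
  then have "norm x \<le> max 0 R" if "f x \<noteq> 0" for x using that by (simp add: le_max_iff_disj)
  then show ?thesis by (intro that[of "max 0 R"]) auto
qed

lemma Cc_nonneg_eq_cc: "Cc_nonneg = (cc :: (real^'d \<Rightarrow> real) set)"
proof -
  have "compact (closure {x. f x \<noteq> 0}) \<longleftrightarrow> (\<exists>R. \<forall>x. f x \<noteq> 0 \<longrightarrow> norm x \<le> R)" for f :: "real^'d \<Rightarrow> real"
    by (auto simp: compact_closure bounded_iff)
  then show ?thesis unfolding Cc_nonneg_def cc_def by blast
qed

lemma cc_borel: "f \<in> cc \<Longrightarrow> f \<in> borel_measurable borel"
  by (simp add: cc_continuous borel_measurable_continuous_onI)

lemma cc_bounded:
  assumes "f \<in> cc" obtains B where "0 \<le> B" "\<And>x. f x \<le> B"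
proof -
  obtain R where R: "0 \<le> R" "\<And>x. f x \<noteq> 0 \<Longrightarrow> norm x \<le> R" using cc_supportE[OF assms] by metis
  have "compact (f ` cball 0 R)"
    by (intro compact_continuous_image continuous_on_subset[OF cc_continuous[OF assms]]) auto
  then obtain B where B: "\<And>y. y \<in> f ` cball 0 R \<Longrightarrow> norm y \<le> B"
    using compact_imp_bounded bounded_iff by metis
  have "f x \<le> max 0 B" for x
  proof (cases "f x = 0")
    case False
    then have "f x \<in> f ` cball 0 R" using R(2)[of x] by auto
    then show ?thesis using B[of "f x"] by auto
  qed auto
  then show ?thesis by (intro that[of "max 0 B"]) auto
qed

lemma cc_level_open: "f \<in> cc \<Longrightarrow> open {x. t < f x}"
  by (intro open_Collect_less continuous_intros cc_continuous)

lemma cc_level_bounded: "f \<in> cc \<Longrightarrow> 0 \<le> t \<Longrightarrow> bounded {x. t < f x}"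
  by (erule cc_supportE) (force simp: bounded_iff)

lemma cc_level_lmeasurable: "f \<in> cc \<Longrightarrow> 0 \<le> t \<Longrightarrow> {x. t < f x} \<in> lmeasurable"
  by (intro lmeasurable_open cc_level_open cc_level_bounded)

lemma cc_level_measure: "f \<in> cc \<Longrightarrow> measure lebesgue {x. t < f x} = measure lborel {x. t < f x}"
  using cc_level_open[of f t] by (simp add: measure_completion borel_open)

lemma measure_level_mono:
  assumes "f \<in> cc" "g \<in> cc" "0 \<le> s" "0 \<le> t" "\<And>x. t < f x \<Longrightarrow> s < g x"
  shows "measure lborel {x. t < f x} \<le> measure lborel {x. s < g x}"
proof -
  have "measure lebesgue {x. t < f x} \<le> measure lebesgue {x. s < g x}"
    using assms(5) cc_level_lmeasurable[of f t] cc_level_lmeasurable[of g s] assms(1-4)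
    by (intro measure_mono_fmeasurable) auto
  then show ?thesis using assms(1,2) by (simp only: cc_level_measure)
qed

text \<open>Apart from nonnegativity, every later property of rearrangements is derived from this
  level criterion rather than from the supremum in the definition.\<close>

lemma rearr_less_iff:
  fixes f :: "'a::euclidean_space \<Rightarrow> real"
  assumes "f \<in> cc" "0 < t"
  shows "t < rearrangement f x \<longleftrightarrow> unit_ball_vol (DIM('a)) * norm x ^ DIM('a) < measure lborel {y. t < f y}"
proof -
  obtain B where B: "\<And>x. f x \<le> B" using cc_bounded[OF assms(1)] by blast
  have "{x. t < rearrangement f x} = sym_ball {x. t < f x}"
  proof (rule superlevel_rearrangement)
    show "f \<in> borel_measurable lebesgue" by (intro measurable_completion) (simp add: cc_borel assms)
    show "emeasure lebesgue {x. t < f x} < \<infinity>" if "0 < t" for t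
      using cc_level_lmeasurable[OF assms(1), of t] that by (auto simp: fmeasurable_def)
  qed (use B assms in auto)
  then have "t < rearrangement f x \<longleftrightarrow> x \<in> sym_ball {x. t < f x}" by blast
  then show ?thesis unfolding in_sym_ball_iff
    using assms(1) by (simp only: cc_level_measure)
qed

lemma rearr_bdd:
  fixes f :: "'a::euclidean_space \<Rightarrow> real"
  assumes "\<And>x. f x \<le> B"
  shows "bdd_above (insert 0 {t. 0 < t \<and> x \<in> sym_ball {y. t < f y}})"
proof -
  have "s \<le> B" if "x \<in> sym_ball {y. s < f y}" for s
  proof (rule ccontr)
    assume "\<not> s \<le> B"
    then have "{y. s < f y} = {}" using assms by (force simp: not_less intro: order_trans)
    with that have "unit_ball_vol (DIM('a)) * norm x ^ DIM('a) < 0"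
      by (simp only: in_sym_ball_iff measure_empty)
    moreover have "0 \<le> unit_ball_vol (DIM('a)) * norm x ^ DIM('a)" by simp
    ultimately show False by linarith
  qed
  then show ?thesis by (auto intro: bdd_aboveI[of _ B])
qed

lemma rearr_nonneg: "f \<in> cc \<Longrightarrow> 0 \<le> rearrangement f x"
  unfolding rearrangement_def by (erule cc_bounded) (intro cSup_upper rearr_bdd, auto)

lemma le_add_if_levels:
  fixes a b e :: real
  assumes "0 \<le> b" "\<And>t. 0 < t \<Longrightarrow> t + e < a \<Longrightarrow> t < b"
  shows "a \<le> b + e"
proof (rule ccontr)
  assume "\<not> a \<le> b + e"
  \<comment> \<open>The level is the midpoint between \<open>b\<close> and \<open>a - e\<close>; it
    is positive because \<open>b\<close> is nonnegative.\<close>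
  then show False using assms(2)[of "(b + (a - e)) / 2"] assms(1) by (simp add: field_simps)
qed

lemma eq_if_levels:
  fixes a b :: real
  assumes "0 \<le> a" "0 \<le> b" "\<And>t. 0 < t \<Longrightarrow> t < a \<longleftrightarrow> t < b"
  shows "a = b"
  using le_add_if_levels[of b 0 a] le_add_if_levels[of a 0 b] assms by auto

text \<open>The level set of \<open>f\<close> at \<open>t + e\<close> is contained in that of
  \<open>g\<close> at \<open>t\<close>. Used in both directions, this gives nonexpansiveness in the
  supremum norm.\<close>

lemma rearr_le_add:
  assumes "f \<in> cc" "g \<in> cc" "0 \<le> e" "\<And>x. f x \<le> g x + e"
  shows "rearrangement f x \<le> rearrangement g x + e"
proof (rule le_add_if_levels)
  fix t :: real assume t: "0 < t" "t + e < rearrangement f x"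
  have "measure lborel {y. t + e < f y} \<le> measure lborel {y. t < g y}"
  proof (rule measure_level_mono)
    show "t < g y" if "t + e < f y" for y using assms(4)[of y] that by linarith
  qed (use assms t in auto)
  then show "t < rearrangement g x"
    using t assms by (simp add: rearr_less_iff)
qed (simp add: rearr_nonneg assms)

text \<open>One pair of a modulus of continuity. The one-sided inequality suffices since
  \<open>x\<close> and \<open>y\<close> may be exchanged; non-strict bounds make it survive
  pointwise limits.\<close>

definition osc :: "real \<Rightarrow> real \<Rightarrow> ('a::real_normed_vector \<Rightarrow> real) \<Rightarrow> bool" where
  "osc \<eta> e g \<longleftrightarrow> (\<forall>x y. norm (x - y) \<le> \<eta> \<longrightarrow> g x \<le> g y + e)"

lemma cc_osc:
  assumes "g \<in> cc" "0 < e" shows "\<exists>\<eta>>0. osc \<eta> e g"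
proof -
  obtain R where R: "0 \<le> R" "\<And>x. g x \<noteq> 0 \<Longrightarrow> norm x \<le> R" using cc_supportE[OF assms(1)] by blast
  \<comment> \<open>The margin 1, together with the cap 1 on the distance below, puts both points
    into this ball as soon as one of them has norm at most \<open>R\<close>.\<close>
  have "uniformly_continuous_on (cball 0 (R+1)) g"
    by (intro compact_uniformly_continuous continuous_on_subset[OF cc_continuous[OF assms(1)]]) auto
  then obtain d where d: "0 < d" "\<And>x y. x \<in> cball 0 (R+1) \<Longrightarrow> y \<in> cball 0 (R+1) \<Longrightarrow> dist y x < d \<Longrightarrow> dist (g y) (g x) < e"
    using \<open>0 < e\<close> unfolding uniformly_continuous_on_def by metis
  have "g x \<le> g y + e" if *: "norm (x - y) \<le> min 1 (d/2)" for x y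
  proof (cases "norm x \<le> R \<or> norm y \<le> R")
    case True
    then have "norm x \<le> R + 1" "norm y \<le> R + 1"
      using * norm_triangle_ineq2[of x y] norm_triangle_ineq2[of y x] R by (auto simp: norm_minus_commute)
    then have "dist (g x) (g y) < e" using d(1) * by (intro d(2)) (auto simp: dist_norm)
    then show ?thesis by (auto simp: dist_real_def)
  next
    case False then show ?thesis using R(2)[of x] R(2)[of y] \<open>0 < e\<close> by force
  qed
  then show ?thesis using d(1) by (intro exI[of _ "min 1 (d/2)"]) (auto simp: osc_def)
qed

lemma osc_continuous:
  assumes "\<And>e. 0 < e \<Longrightarrow> \<exists>\<eta>>0. osc \<eta> e g" shows "continuous_on UNIV g"
  unfolding continuous_on_iff
proof (intro ballI allI impI)
  fix x :: 'a and e :: real assume "0 < e"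
  then obtain \<eta> where \<eta>: "\<eta> > 0" "osc \<eta> (e/2) g" using assms[of "e/2"] by auto
  have "dist (g y) (g x) < e" if "dist y x < \<eta>" for y
  proof -
    have "norm (x - y) \<le> \<eta>" "norm (y - x) \<le> \<eta>" using that by (auto simp: dist_norm norm_minus_commute)
    then have "g x \<le> g y + e/2" "g y \<le> g x + e/2" using \<eta>(2) by (auto simp: osc_def)
    then show ?thesis using \<open>0 < e\<close> unfolding dist_real_def by linarith
  qed
  then show "\<exists>d>0. \<forall>x'\<in>UNIV. dist x' x < d \<longrightarrow> dist (g x') (g x) < e" using \<eta>(1) by auto
qed

text \<open>A one-dimensional Brunn-Minkowski inequality. Shift \<open>A\<close> to the left by
  \<open>\<tau>\<close> and add the interval of length \<open>2 * \<tau>\<close> centred at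
  \<open>Sup A\<close>: the two pieces are disjoint and both lie in \<open>B\<close>.\<close>

lemma measure_thickening_ge:
  fixes A B :: "real set"
  assumes "open A" "bounded A" "A \<noteq> {}" "open B" "bounded B" "0 \<le> \<tau>"
    and sub: "\<And>a s. a \<in> A \<Longrightarrow> \<bar>s - a\<bar> \<le> \<tau> \<Longrightarrow> s \<in> B"
  shows "measure lborel A + 2 * \<tau> \<le> measure lborel B"
proof -
  define m where "m = Sup A"
  have bdd: "bdd_above A" using \<open>bounded A\<close> by (rule bounded_imp_bdd_above)
  have up: "a \<le> m" if "a \<in> A" for a using that bdd by (auto simp: m_def intro: cSup_upper)
  have lm: "A \<in> lmeasurable" "B \<in> lmeasurable" using assms by (auto intro: lmeasurable_open)
  define A' where "A' = (\<lambda>a. -\<tau> + a) ` A"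
  have A': "A' \<in> lmeasurable" "measure lebesgue A' = measure lebesgue A"
    unfolding A'_def by (rule measurable_translation[OF lm(1)], rule measure_translation)
  define I where "I = {m - \<tau><..<m + \<tau>}"
  have I: "I \<in> lmeasurable" "measure lebesgue I = 2 * \<tau>" using \<open>0 \<le> \<tau>\<close> unfolding I_def
    by (auto simp: measure_completion)
  have "A' \<inter> I = {}" using up by (force simp: A'_def I_def)
  then have "measure lebesgue (A' \<union> I) = measure lebesgue A + 2 * \<tau>"
    using A' I by (simp add: measure_Un3)
  moreover have "A' \<union> I \<subseteq> B"
  proof
    fix s assume "s \<in> A' \<union> I"
    then show "s \<in> B"
    proof
      assume "s \<in> A'" then show ?thesis using sub \<open>0 \<le> \<tau>\<close> by (auto simp: A'_def)
    next
      assume s: "s \<in> I"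
      then have "s - \<tau> < m" by (auto simp: I_def)
      \<comment> \<open>Such an \<open>a\<close> also satisfies
        \<open>a \<le> m < s + \<tau>\<close>, so \<open>s\<close> is within \<open>\<tau>\<close>
        of it.\<close>
      then obtain a where a: "a \<in> A" "s - \<tau> < a" using \<open>A \<noteq> {}\<close> bdd unfolding m_def by (meson less_cSupD)
      then show ?thesis using up[OF a(1)] s by (intro sub[OF a(1)]) (auto simp: I_def)
    qed
  qed
  then have "measure lebesgue (A' \<union> I) \<le> measure lebesgue B"
    using A'(1) I(1) lm by (intro measure_mono_fmeasurable) (auto dest: fmeasurableD)
  ultimately show ?thesis using assms by (simp add: measure_completion borel_open)
qed

text \<open>Only the component of \<open>x\<close> orthogonal to \<open>u\<close> matters. The
  general types admit \<open>ennreal\<close>-valued integrands and the horizontal direction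
  \<open>(u, 0)\<close> in the space that contains subgraphs.\<close>

definition line :: "'a::real_inner \<Rightarrow> ('a \<Rightarrow> 'b) \<Rightarrow> 'a \<Rightarrow> real \<Rightarrow> 'b" where
  "line u g x s = g (x - (x \<bullet> u) *\<^sub>R u + s *\<^sub>R u)"

lemma inner_line:
  assumes "norm u = 1" shows "(x - (x \<bullet> u) *\<^sub>R u + s *\<^sub>R u) \<bullet> u = s"
  using assms by (simp add: inner_left_distrib inner_diff_left norm_eq_1)

lemma line_add: "norm u = 1 \<Longrightarrow> line u g (x + s *\<^sub>R u) = line u g x"
  by (rule ext) (simp add: line_def norm_eq_1 algebra_simps)

lemma abs_le_norm_line:
  assumes "norm u = 1" shows "\<bar>s\<bar> \<le> norm (x - (x \<bullet> u) *\<^sub>R u + s *\<^sub>R u)"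
  using Cauchy_Schwarz_ineq2[of "x - (x \<bullet> u) *\<^sub>R u + s *\<^sub>R u" u] inner_line[OF assms, of x s] assms by simp

lemma norm_line:
  assumes "norm u = 1"
  shows "(norm (x - (x \<bullet> u) *\<^sub>R u + s *\<^sub>R u))\<^sup>2 = (norm x)\<^sup>2 - (x \<bullet> u)\<^sup>2 + s\<^sup>2"
  using assms unfolding power2_norm_eq_inner
  by (simp add: norm_eq_1 inner_commute algebra_simps power2_eq_square)

lemma line_cc:
  assumes "g \<in> cc" "norm u = 1" shows "line u g x \<in> cc"
proof -
  obtain R where R: "0 \<le> R" "\<And>x. g x \<noteq> 0 \<Longrightarrow> norm x \<le> R" using cc_supportE[OF assms(1)] by blast
  have "continuous_on UNIV (\<lambda>s. g (x - (x \<bullet> u) *\<^sub>R u + s *\<^sub>R u))"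
    by (intro continuous_on_compose2[OF cc_continuous[OF assms(1)]] continuous_intros) auto
  moreover have "\<bar>s\<bar> \<le> R" if "g (x - (x \<bullet> u) *\<^sub>R u + s *\<^sub>R u) \<noteq> 0" for s
    using R(2)[OF that] abs_le_norm_line[OF assms(2), of s x] by linarith
  ultimately show ?thesis using cc_nonneg[OF assms(1)] unfolding cc_def line_def by (auto intro!: exI[of _ R])
qed

lemma steiner_line: "steiner u f x = rearrangement (line u f x) (x \<bullet> u)"
  unfolding steiner_def line_def ..

lemma steiner_less_iff:
  assumes "g \<in> cc" "norm u = 1" "0 < t"
  shows "t < steiner u g x \<longleftrightarrow> 2 * \<bar>x \<bullet> u\<bar> < measure lborel {s. t < line u g x s}"
  unfolding steiner_line using rearr_less_iff[OF line_cc[OF assms(1,2)] assms(3), where x="x \<bullet> u"]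
  by (simp add: unit_ball_vol_1)

lemma steiner_nonneg: "g \<in> cc \<Longrightarrow> norm u = 1 \<Longrightarrow> 0 \<le> steiner u g x"
  unfolding steiner_line by (intro rearr_nonneg line_cc)

lemma steiner_le_add:
  assumes "f \<in> cc" "g \<in> cc" "norm u = 1" "0 \<le> e" "\<And>x. f x \<le> g x + e"
  shows "steiner u f x \<le> steiner u g x + e"
  unfolding steiner_line using assms by (intro rearr_le_add line_cc) (auto simp: line_def)

text \<open>Thickening the level set over \<open>x\<close> at level \<open>t + e\<close> by
  \<open>\<tau>\<close> stays inside the level set over \<open>y\<close> at level \<open>t\<close>.
  The gain \<open>2 * \<tau>\<close> in length pays for the difference between
  \<open>\<bar>x \<bullet> u\<bar>\<close> and \<open>\<bar>y \<bullet> u\<bar>\<close>, so the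
  modulus is preserved without loss.\<close>

lemma steiner_osc:
  fixes g :: "real^'d \<Rightarrow> real"
  assumes "g \<in> cc" "norm u = 1" "osc \<eta> e g" "0 \<le> \<eta>"
  shows "osc \<eta> e (steiner u g)"
  unfolding osc_def
proof (intro allI impI)
  fix x y :: "real^'d" assume xy: "norm (x - y) \<le> \<eta>"
  have "g 0 \<le> g 0 + e" using assms(3,4) unfolding osc_def by (metis diff_self norm_zero)
  then have e: "0 \<le> e" by simp
  define \<tau> where "\<tau> = \<bar>x \<bullet> u - y \<bullet> u\<bar>"
  show "steiner u g x \<le> steiner u g y + e"
  proof (rule le_add_if_levels)
    fix t :: real assume t: "0 < t" "t + e < steiner u g x"
    let ?A = "{s. t + e < line u g x s}" and ?B = "{s. t < line u g y s}"
    have A: "2 * \<bar>x \<bullet> u\<bar> < measure lborel ?A" using steiner_less_iff[OF assms(1,2), of "t + e"] t e by simp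
    have "measure lborel ?A + 2 * \<tau> \<le> measure lborel ?B"
    proof (rule measure_thickening_ge)
      show "?A \<noteq> {}"
      proof
        assume "?A = {}"
        then have "measure lborel ?A = 0" by (metis measure_empty)
        then show False using A by auto
      qed
      fix a s assume a: "a \<in> ?A" and s: "\<bar>s - a\<bar> \<le> \<tau>"
      \<comment> \<open>By Pythagoras, replacing the component of \<open>x - y\<close> along
        \<open>u\<close>, of size \<open>\<tau>\<close>, by the component \<open>a - s\<close>, of
        size at most \<open>\<tau>\<close>, cannot lengthen the vector.\<close>
      let ?d = "(x - (x \<bullet> u) *\<^sub>R u) - (y - (y \<bullet> u) *\<^sub>R u)"
      have 1: "?d = (x - y) - ((x - y) \<bullet> u) *\<^sub>R u" by (simp add: algebra_simps)
      have "(norm (?d + (a - s) *\<^sub>R u))\<^sup>2 = (norm (x - y))\<^sup>2 - \<tau>\<^sup>2 + (a - s)\<^sup>2"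
        unfolding 1 norm_line[OF assms(2)] by (simp add: \<tau>_def inner_diff_left)
      also have "\<dots> \<le> (norm (x - y))\<^sup>2"
      proof -
        have "\<bar>a - s\<bar> \<le> \<bar>\<tau>\<bar>" using s by (auto simp: \<tau>_def)
        then show ?thesis using abs_le_square_iff[of "a - s" \<tau>] by simp
      qed
      finally have "norm (?d + (a - s) *\<^sub>R u) \<le> norm (x - y)" by (rule power2_le_imp_le) simp
      then have "norm ((x - (x \<bullet> u) *\<^sub>R u + a *\<^sub>R u) - (y - (y \<bullet> u) *\<^sub>R u + s *\<^sub>R u)) \<le> \<eta>"
        using xy by (simp add: algebra_simps)
      then have "line u g x a \<le> line u g y s + e" using assms(3) unfolding osc_def line_def by blast
      then show "s \<in> ?B" using a by auto
    qed (use assms t e line_cc in \<open>auto intro!: cc_level_open cc_level_bounded simp: \<tau>_def\<close>)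
    moreover have "\<bar>y \<bullet> u\<bar> \<le> \<bar>x \<bullet> u\<bar> + \<tau>" by (simp add: \<tau>_def)
    ultimately have "2 * \<bar>y \<bullet> u\<bar> < measure lborel ?B" using A by linarith
    then show "t < steiner u g y" using steiner_less_iff[OF assms(1,2)] t by simp
  qed (use assms steiner_nonneg in auto)
qed

text \<open>A centred ball meets each line parallel to \<open>u\<close> in a segment symmetric about
  the hyperplane orthogonal to \<open>u\<close>; a centred interval no longer than this segment
  stays in it.\<close>

lemma steiner_support:
  assumes "g \<in> cc" "norm u = 1" "\<And>x. g x \<noteq> 0 \<Longrightarrow> norm x \<le> R" "0 \<le> R" "steiner u g x \<noteq> 0"
  shows "norm x \<le> R"
proof -
  define t where "t = steiner u g x / 2"
  have t: "0 < t" "t < steiner u g x" using assms steiner_nonneg[OF assms(1,2), of x] by (auto simp: t_def)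
  let ?A = "{s. t < line u g x s}"
  have A: "2 * \<bar>x \<bullet> u\<bar> < measure lborel ?A" using steiner_less_iff[OF assms(1,2)] t by simp
  \<comment> \<open>The squared half-length of the chord that the ball of radius \<open>R\<close>
    cuts from the line through \<open>x\<close>; it is negative if the line misses the ball.\<close>
  define q where "q = R\<^sup>2 - ((norm x)\<^sup>2 - (x \<bullet> u)\<^sup>2)"
  have in_A: "s\<^sup>2 \<le> q" if "s \<in> ?A" for s
  proof -
    have "norm (x - (x \<bullet> u) *\<^sub>R u + s *\<^sub>R u) \<le> R" using that t by (intro assms(3)) (auto simp: line_def)
    then have "(norm (x - (x \<bullet> u) *\<^sub>R u + s *\<^sub>R u))\<^sup>2 \<le> R\<^sup>2" by (simp add: power_mono)
    then show ?thesis unfolding norm_line[OF assms(2)] q_def by simp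
  qed
  have "?A \<noteq> {}"
  proof
    assume "?A = {}"
    then have "measure lborel ?A = 0" by (metis measure_empty)
    then show False using A by auto
  qed
  then have "0 \<le> q" using in_A by (metis (no_types, lifting) all_not_in_conv order_trans zero_le_power2)
  have "?A \<subseteq> {-sqrt q..sqrt q}" using in_A real_sqrt_le_mono[of "_\<^sup>2" q] by (force simp: abs_le_iff)
  then have "measure lborel ?A \<le> measure lborel {-sqrt q..sqrt q}"
    by (intro measure_mono_fmeasurable) (auto simp: borel_open cc_level_open line_cc assms fmeasurable_compact)
  then have "\<bar>x \<bullet> u\<bar> \<le> sqrt q" using A \<open>0 \<le> q\<close> by simp
  then have "(x \<bullet> u)\<^sup>2 \<le> q" using \<open>0 \<le> q\<close> by (metis abs_le_square_iff real_sqrt_pow2 abs_of_nonneg real_sqrt_ge_zero)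
  then have "(norm x)\<^sup>2 \<le> R\<^sup>2" by (simp add: q_def)
  then show ?thesis using \<open>0 \<le> R\<close> by (rule power2_le_imp_le)
qed

lemma steiner_cc:
  assumes "g \<in> cc" "norm u = 1" shows "steiner u g \<in> cc"
proof -
  obtain R where R: "0 \<le> R" "\<And>x. g x \<noteq> 0 \<Longrightarrow> norm x \<le> R" using cc_supportE[OF assms(1)] by blast
  have "continuous_on UNIV (steiner u g)"
    using cc_osc[OF assms(1)] steiner_osc[OF assms] by (intro osc_continuous) (meson less_imp_le)
  then show ?thesis using steiner_support[OF assms R(2,1)] steiner_nonneg[OF assms] by (auto simp: cc_def)
qed

section \<open>Equimeasurability and the second moment\<close>

lemma nn_integral_lborel_translate:
  fixes h :: "'a::euclidean_space \<Rightarrow> ennreal"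
  assumes [measurable]: "h \<in> borel_measurable borel"
  shows "(\<integral>\<^sup>+x. h (x + c) \<partial>lborel) = (\<integral>\<^sup>+x. h x \<partial>lborel)"
proof -
  have "(\<integral>\<^sup>+x. h x \<partial>lborel) = (\<integral>\<^sup>+x. h x \<partial>distr lborel borel ((+) c))"
    by (simp only: lborel_distr_plus)
  also have "\<dots> = (\<integral>\<^sup>+x. h (x + c) \<partial>lborel)"
    by (subst nn_integral_distr) (simp_all add: add.commute)
  finally show ?thesis by simp
qed

lemma nn_integral_reflect:
  fixes \<phi> :: "real \<Rightarrow> ennreal"
  assumes [measurable]: "\<phi> \<in> borel_measurable borel"
  shows "(\<integral>\<^sup>+s. \<phi> (c - s) \<partial>lborel) = (\<integral>\<^sup>+s. \<phi> s \<partial>lborel)"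
  using nn_integral_real_affine[of \<phi> "-1" c] by simp

text \<open>Averaging over translations along \<open>u\<close> with density \<open>\<phi>\<close> makes the decomposition of space into
  lines parallel to \<open>u\<close> a consequence of translation invariance, without rotating coordinates.\<close>
lemma nn_integral_directional:
  fixes h :: "'a::euclidean_space \<Rightarrow> ennreal" and \<phi> :: "real \<Rightarrow> ennreal"
  assumes [measurable]: "h \<in> borel_measurable borel" "\<phi> \<in> borel_measurable borel"
    and u: "norm u = 1" and \<phi>: "(\<integral>\<^sup>+s. \<phi> s \<partial>lborel) = 1"
  shows "(\<integral>\<^sup>+x. h x \<partial>lborel) = (\<integral>\<^sup>+x. \<phi> (x \<bullet> u) * (\<integral>\<^sup>+s. line u h x s \<partial>lborel) \<partial>lborel)"
proof -
  have uu: "u \<bullet> u = 1" using u by (simp add: norm_eq_1)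
  have "(\<integral>\<^sup>+s. line u h x s \<partial>lborel) = (\<integral>\<^sup>+s. h (x + s *\<^sub>R u) \<partial>lborel)" for x
  proof -
    have "(\<integral>\<^sup>+s. line u h x s \<partial>lborel) = (\<integral>\<^sup>+s. line u h x (s + (x \<bullet> u)) \<partial>lborel)"
      unfolding line_def by (subst nn_integral_lborel_translate) simp_all
    also have "\<dots> = (\<integral>\<^sup>+s. h (x + s *\<^sub>R u) \<partial>lborel)"
      by (simp add: line_def scaleR_add_left algebra_simps)
    finally show ?thesis .
  qed
  then have "(\<integral>\<^sup>+x. \<phi> (x \<bullet> u) * (\<integral>\<^sup>+s. line u h x s \<partial>lborel) \<partial>lborel)
      = (\<integral>\<^sup>+x. (\<integral>\<^sup>+s. \<phi> (x \<bullet> u) * h (x + s *\<^sub>R u) \<partial>lborel) \<partial>lborel)"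
    by (simp add: nn_integral_cmult)
  also have "\<dots> = (\<integral>\<^sup>+s. (\<integral>\<^sup>+x. \<phi> (x \<bullet> u) * h (x + s *\<^sub>R u) \<partial>lborel) \<partial>lborel)"
    by (rule lborel_pair.Fubini') simp
  \<comment> \<open>Translating \<open>x\<close> by \<open>s *\<^sub>R u\<close> moves the
    dependence on \<open>s\<close> from \<open>h\<close> to \<open>\<phi>\<close>, whose integral
    over \<open>s\<close> is then 1.\<close>
  also have "\<dots> = (\<integral>\<^sup>+s. (\<integral>\<^sup>+x. \<phi> (x \<bullet> u - s) * h x \<partial>lborel) \<partial>lborel)"
  proof (rule nn_integral_cong)
    fix s :: real
    show "(\<integral>\<^sup>+x. \<phi> (x \<bullet> u) * h (x + s *\<^sub>R u) \<partial>lborel) = (\<integral>\<^sup>+x. \<phi> (x \<bullet> u - s) * h x \<partial>lborel)"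
      using nn_integral_lborel_translate[of "\<lambda>x. \<phi> (x \<bullet> u - s) * h x" "s *\<^sub>R u"]
      by (simp add: inner_left_distrib uu)
  qed
  also have "\<dots> = (\<integral>\<^sup>+x. (\<integral>\<^sup>+s. \<phi> (x \<bullet> u - s) * h x \<partial>lborel) \<partial>lborel)"
    by (rule lborel_pair.Fubini') simp
  also have "\<dots> = (\<integral>\<^sup>+x. h x \<partial>lborel)"
    by (simp add: nn_integral_multc nn_integral_reflect \<phi>)
  finally show ?thesis ..
qed

lemma borel_measurable_fst_snd [measurable]:
  "fst \<in> borel_measurable (borel :: ('a::topological_space \<times> 'b::topological_space) measure)"
  "snd \<in> borel_measurable (borel :: ('a::topological_space \<times> 'b::topological_space) measure)"
  by (auto intro!: borel_measurable_continuous_onI continuous_on_fst continuous_on_snd continuous_on_id)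

lemma nn_integral_eq_if_lines:
  fixes h k :: "'a::euclidean_space \<Rightarrow> ennreal"
  assumes "h \<in> borel_measurable borel" "k \<in> borel_measurable borel" and "norm u = 1"
    and "\<And>x. (\<integral>\<^sup>+s. line u h x s \<partial>lborel) = (\<integral>\<^sup>+s. line u k x s \<partial>lborel)"
  shows "(\<integral>\<^sup>+x. h x \<partial>lborel) = (\<integral>\<^sup>+x. k x \<partial>lborel)"
  \<comment> \<open>The averaging density is the uniform one on the unit interval.\<close>
  using nn_integral_directional[of _ "indicator {0..1}" u] assms by simp

lemma line_point_line:
  assumes "norm u = 1" shows "line u g (x - (x \<bullet> u) *\<^sub>R u + s *\<^sub>R u) = line u g x"
proof -
  have "x - (x \<bullet> u) *\<^sub>R u + s *\<^sub>R u = x + (s - x \<bullet> u) *\<^sub>R u" by (simp add: algebra_simps)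
  then show ?thesis by (simp only: line_add[OF assms])
qed

lemma steiner_line_less_iff:
  assumes "g \<in> cc" "norm u = 1" "0 < t"
  shows "t < line u (steiner u g) x s \<longleftrightarrow> 2 * \<bar>s\<bar> < measure lborel {s. t < line u g x s}"
  using steiner_less_iff[OF assms, of "x - (x \<bullet> u) *\<^sub>R u + s *\<^sub>R u"]
  by (simp add: line_def[of u "steiner u g"] line_point_line[OF assms(2)] inner_line[OF assms(2)])

lemma emeasure_line_level:
  assumes "g \<in> cc" "norm u = 1" "0 \<le> t"
  shows "emeasure lborel {s. t < line u g x s} = ennreal (measure lborel {s. t < line u g x s})"
proof -
  have "emeasure lborel {s. t < line u g x s} < \<infinity>"
    using cc_level_bounded[OF line_cc[OF assms(1,2)] assms(3)] by (rule emeasure_bounded_finite)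
  then have "emeasure lborel {s. t < line u g x s} \<noteq> \<top>" by simp
  then show ?thesis by (rule emeasure_eq_ennreal_measure)
qed

lemma emeasure_steiner_line_level:
  assumes "g \<in> cc" "norm u = 1" "0 < t"
  shows "emeasure lborel {s. t < line u (steiner u g) x s} = ennreal (measure lborel {s. t < line u g x s})"
proof -
  let ?m = "measure lborel {s. t < line u g x s}"
  have "{s. t < line u (steiner u g) x s} = {- ?m / 2 <..< ?m / 2}"
    unfolding steiner_line_less_iff[OF assms] by auto
  then show ?thesis by simp
qed

text \<open>Cavalieri's principle: on every line parallel to \<open>u\<close> the two level sets
  have the same length.\<close>

lemma measure_steiner_level:
  assumes "g \<in> cc" "norm u = 1" "0 < t"
  shows "measure lborel {x. t < steiner u g x} = measure lborel {x. t < g x}"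
proof -
  have S: "steiner u g \<in> cc" by (rule steiner_cc[OF assms(1,2)])
  have "(\<integral>\<^sup>+x. indicator {x. t < steiner u g x} x \<partial>lborel) = (\<integral>\<^sup>+x. indicator {x. t < g x} x \<partial>lborel)"
  proof (rule nn_integral_eq_if_lines[OF _ _ assms(2)])
    fix x
    have *: "(\<integral>\<^sup>+s. line u (indicator {x. t < k x}) x s \<partial>lborel) = emeasure lborel {s. t < line u k x s}"
      if "k \<in> cc" for k :: "real^'a \<Rightarrow> real"
    proof -
      have "line u (indicator {x. t < k x}) x s = (indicator {s. t < line u k x s} s :: ennreal)" for s
        by (simp add: line_def indicator_def)
      then show ?thesis using cc_level_open[OF line_cc[OF that assms(2)]] by (simp add: borel_open)
    qed
    show "(\<integral>\<^sup>+s. line u (indicator {x. t < steiner u g x}) x s \<partial>lborel) = (\<integral>\<^sup>+s. line u (indicator {x. t < g x}) x s \<partial>lborel)"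
      unfolding *[OF S] *[OF assms(1)] emeasure_steiner_line_level[OF assms]
      using assms by (simp add: emeasure_line_level)
  qed (use S assms in \<open>auto intro!: borel_measurable_indicator simp: borel_open cc_level_open\<close>)
  then have "emeasure lborel {x. t < steiner u g x} = emeasure lborel {x. t < g x}"
    using cc_level_open[OF S] cc_level_open[OF assms(1)] by (simp add: borel_open)
  then show ?thesis by (simp add: measure_def)
qed

lemma rearr_steiner:
  assumes "g \<in> cc" "norm u = 1"
  shows "rearrangement (steiner u g) = rearrangement g"
proof
  fix x
  show "rearrangement (steiner u g) x = rearrangement g x"
    using assms steiner_cc[OF assms] by (intro eq_if_levels) (simp_all add: rearr_nonneg rearr_less_iff measure_steiner_level)
qed

text \<open>By the layer-cake formula, integrals against \<open>g\<close> become integrals over this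
  set, so symmetrizing a function turns into symmetrizing a set in one more dimension, along
  \<open>(u, 0)\<close>.\<close>

definition subgraph :: "('a \<Rightarrow> real) \<Rightarrow> ('a \<times> real) set" where
  "subgraph g = {p. 0 < snd p \<and> snd p < g (fst p)}"

lemma open_subgraph:
  fixes g :: "'a::euclidean_space \<Rightarrow> real"
  assumes "g \<in> cc" shows "open (subgraph g)"
  unfolding subgraph_def
  by (intro open_Collect_conj open_Collect_less continuous_intros continuous_on_compose2[OF cc_continuous[OF assms]]) auto

lemma nn_integral_subgraph:
  fixes g w :: "'a::euclidean_space \<Rightarrow> real"
  assumes "g \<in> cc" and [measurable]: "w \<in> borel_measurable borel" and "\<And>x. 0 \<le> w x"
  shows "(\<integral>\<^sup>+p. ennreal (w (fst p)) * indicator (subgraph g) p \<partial>lborel) = (\<integral>\<^sup>+x. ennreal (w x * g x) \<partial>lborel)"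
proof -
  have [measurable]: "subgraph g \<in> sets borel" using open_subgraph[OF assms(1)] by (rule borel_open)
  have [measurable]: "(\<lambda>p::'a \<times> real. w (fst p)) \<in> borel_measurable borel"
    using measurable_compose[OF borel_measurable_fst_snd(1) assms(2)] .
  have "(\<integral>\<^sup>+p. ennreal (w (fst p)) * indicator (subgraph g) p \<partial>lborel)
      = (\<integral>\<^sup>+p. ennreal (w (fst p)) * indicator (subgraph g) p \<partial>(lborel \<Otimes>\<^sub>M lborel))"
    by (simp only: lborel_prod)
  also have "\<dots> = (\<integral>\<^sup>+x. (\<integral>\<^sup>+t. ennreal (w x) * indicator (subgraph g) (x, t) \<partial>lborel) \<partial>lborel)"
    by (subst lborel.nn_integral_fst[symmetric]) (simp_all add: lborel_prod)
  also have "\<dots> = (\<integral>\<^sup>+x. ennreal (w x * g x) \<partial>lborel)"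
  proof (rule nn_integral_cong)
    fix x :: 'a
    have "(indicator (subgraph g) (x, t) :: ennreal) = indicator {0<..<g x} t" for t
      by (simp add: subgraph_def indicator_def)
    then show "(\<integral>\<^sup>+t. ennreal (w x) * indicator (subgraph g) (x, t) \<partial>lborel) = ennreal (w x * g x)"
      using assms(3)[of x] cc_nonneg[OF assms(1), of x] by (simp add: nn_integral_cmult ennreal_mult')
  qed
  finally show ?thesis .
qed

section \<open>The second moment and its loss under symmetrization\<close>

definition moment :: "('a::euclidean_space \<Rightarrow> real) \<Rightarrow> real" where
  "moment g = (LINT x|lborel. (norm x)\<^sup>2 * g x)"

lemma integrable_cc:
  fixes g w :: "'a::euclidean_space \<Rightarrow> real"
  assumes "g \<in> cc" "continuous_on UNIV w"
  shows "integrable lborel (\<lambda>x. w x * g x)"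
proof -
  obtain R where R: "0 \<le> R" "\<And>x. g x \<noteq> 0 \<Longrightarrow> norm x \<le> R" using cc_supportE[OF assms(1)] by blast
  have "integrable lborel (\<lambda>x. indicator (cball 0 R) x *\<^sub>R (w x * g x))"
    by (intro borel_integrable_compact continuous_intros)
      (auto intro: continuous_on_subset[OF assms(2)] continuous_on_subset[OF cc_continuous[OF assms(1)]])
  moreover have "(\<lambda>x. indicator (cball 0 R) x *\<^sub>R (w x * g x)) = (\<lambda>x. w x * g x)"
    using R(2) by (auto simp: indicator_def fun_eq_iff)
  ultimately show ?thesis by simp
qed

lemma nn_integral_subgraph_cc:
  fixes g w :: "'a::euclidean_space \<Rightarrow> real"
  assumes "g \<in> cc" "continuous_on UNIV w" "\<And>x. 0 \<le> w x"
  shows "(\<integral>\<^sup>+p. ennreal (w (fst p)) * indicator (subgraph g) p \<partial>lborel) = ennreal (LINT x|lborel. w x * g x)"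
  using assms cc_nonneg[OF assms(1)]
  by (subst nn_integral_subgraph) (auto intro!: nn_integral_eq_integral integrable_cc borel_measurable_continuous_onI)

lemma moment_nonneg: "g \<in> cc \<Longrightarrow> 0 \<le> moment g"
  unfolding moment_def by (intro integral_nonneg_AE) (simp add: cc_nonneg)

context
  fixes g :: "real^'d \<Rightarrow> real" and u :: "real^'d"
  assumes g: "g \<in> cc" and u: "norm u = 1"
begin

private lemma Sg: "steiner u g \<in> cc" by (rule steiner_cc[OF g u])

text \<open>The length of the section of \<open>subgraph g\<close> by the line through
  \<open>p\<close> in direction \<open>(u, 0)\<close>. The value 0 at nonpositive heights matches
  the empty section there.\<close>

definition fibre_length :: "(real^'d) \<times> real \<Rightarrow> real" where
  "fibre_length p = (if 0 < snd p then measure lborel {s. snd p < line u g (fst p) s} else 0)"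

text \<open>Let \<open>F\<close> and \<open>F'\<close> be the subgraphs of \<open>g\<close> and of its symmetrization. Since \<open>F'\<close> is cut out of each
  fibre by \<open>(norm (fst p))\<^sup>2 < threshold p\<close>, replacing \<open>F\<close> by \<open>F'\<close> decreases the integral of
  \<open>(norm (fst p))\<^sup>2 - threshold p\<close>; and as the threshold is constant along fibres, it has the same
  integral over \<open>F\<close> and \<open>F'\<close>.\<close>
definition threshold :: "(real^'d) \<times> real \<Rightarrow> real" where
  "threshold p = (fibre_length p / 2)\<^sup>2 + ((norm (fst p))\<^sup>2 - (fst p \<bullet> u)\<^sup>2)"

private lemma line_pair: "line (u, 0::real) h p s = h (fst p - (fst p \<bullet> u) *\<^sub>R u + s *\<^sub>R u, snd p)"
  by (cases p) (simp add: line_def)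

private lemma norm_u0: "norm (u, 0::real) = 1" using u by (simp add: norm_Pair)

private lemma line_indicator_subgraph:
  "line (u, 0::real) (indicator (subgraph k)) p s = (if 0 < snd p then indicator {s. snd p < line u k (fst p) s} s else 0 :: 'z::zero_neq_one)"
  by (simp add: subgraph_def line_def indicator_def inner_prod_def)

private lemma nn_fibre: "(\<integral>\<^sup>+s. line (u, 0::real) (indicator (subgraph g)) p s \<partial>lborel) = ennreal (fibre_length p)"
  using cc_level_open[OF line_cc[OF g u]] emeasure_line_level[OF g u]
  by (simp add: line_indicator_subgraph fibre_length_def borel_open)

private lemma nn_fibre_steiner: "(\<integral>\<^sup>+s. line (u, 0::real) (indicator (subgraph (steiner u g))) p s \<partial>lborel) = ennreal (fibre_length p)"
  using cc_level_open[OF line_cc[OF Sg u]] emeasure_steiner_line_level[OF g u]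
  by (simp add: line_indicator_subgraph fibre_length_def borel_open)

private lemma fibre_length_nonneg: "0 \<le> fibre_length p"
  by (simp add: fibre_length_def)

private lemma subgraph_borel [measurable]: "subgraph g \<in> sets borel" "subgraph (steiner u g) \<in> sets borel"
  using open_subgraph g Sg by (auto intro: borel_open)

text \<open>The fibre length is the inner integral of a jointly measurable indicator, so Tonelli's
  theorem gives measurability.\<close>

private lemma fibre_length_borel [measurable]: "fibre_length \<in> borel_measurable borel"
proof -
  let ?T = "\<lambda>q. (fst (fst q) - (fst (fst q) \<bullet> u) *\<^sub>R u + snd q *\<^sub>R u, snd (fst q)) :: (real^'d) \<times> real"
  have "?T \<in> borel_measurable borel"
    by (intro borel_measurable_continuous_onI continuous_intros)
  then have "(\<lambda>q. indicator (subgraph g) (?T q) :: ennreal) \<in> borel_measurable borel"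
    by (rule measurable_compose) simp
  then have "(\<lambda>q. indicator (subgraph g) (?T q) :: ennreal) \<in> borel_measurable (borel \<Otimes>\<^sub>M lborel)"
    by (simp add: borel_prod[symmetric] cong: measurable_cong_sets sets_pair_measure_cong)
  then have "(\<lambda>p. \<integral>\<^sup>+s. indicator (subgraph g) (?T (p, s)) \<partial>lborel) \<in> borel_measurable borel"
    by (intro lborel.borel_measurable_nn_integral) (simp add: case_prod_beta)
  then have "(\<lambda>p. enn2real (\<integral>\<^sup>+s. line (u, 0::real) (indicator (subgraph g)) p s \<partial>lborel)) \<in> borel_measurable borel"
    unfolding line_pair by simp
  then show ?thesis unfolding nn_fibre by (simp add: fibre_length_nonneg)
qed

private lemma threshold_borel [measurable]: "threshold \<in> borel_measurable borel"
proof -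
  have "(\<lambda>p. (norm (fst p))\<^sup>2 - (fst p \<bullet> u)\<^sup>2) \<in> borel_measurable (borel :: ((real^'d) \<times> real) measure)"
    by (intro borel_measurable_continuous_onI continuous_intros)
  then show ?thesis unfolding threshold_def by measurable
qed

private lemma norm_fst_borel [measurable]:
  "(\<lambda>p. ennreal ((norm (fst p))\<^sup>2)) \<in> borel_measurable (borel :: ((real^'d) \<times> real) measure)"
  by (intro measurable_compose[OF _ measurable_ennreal] borel_measurable_continuous_onI continuous_intros)

private lemma threshold_line: "threshold (fst p - (fst p \<bullet> u) *\<^sub>R u + s *\<^sub>R u, snd p) = threshold p"
  by (simp add: threshold_def fibre_length_def line_point_line[OF u] norm_line[OF u] inner_line[OF u])

private lemma nn_threshold:
  "(\<integral>\<^sup>+p. ennreal (threshold p) * indicator (subgraph g) p \<partial>lborel)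
    = (\<integral>\<^sup>+p. ennreal (threshold p) * indicator (subgraph (steiner u g)) p \<partial>lborel)"
proof (rule nn_integral_eq_if_lines[OF _ _ norm_u0])
  fix p
  have *: "(\<integral>\<^sup>+s. line (u, 0::real) (\<lambda>p. ennreal (threshold p) * indicator A p) p s \<partial>lborel)
     = ennreal (threshold p) * (\<integral>\<^sup>+s. line (u, 0::real) (indicator A) p s \<partial>lborel)" if "A \<in> sets borel" for A
  proof -
    have "(\<integral>\<^sup>+s. line (u, 0::real) (\<lambda>p. ennreal (threshold p) * indicator A p) p s \<partial>lborel)
      = (\<integral>\<^sup>+s. ennreal (threshold p) * line (u, 0::real) (indicator A) p s \<partial>lborel)"
      unfolding line_pair threshold_line ..
    also have "\<dots> = ennreal (threshold p) * (\<integral>\<^sup>+s. line (u, 0::real) (indicator A) p s \<partial>lborel)"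
      unfolding line_pair using that by (intro nn_integral_cmult) simp
    finally show ?thesis .
  qed
  show "(\<integral>\<^sup>+s. line (u, 0::real) (\<lambda>p. ennreal (threshold p) * indicator (subgraph g) p) p s \<partial>lborel)
    = (\<integral>\<^sup>+s. line (u, 0::real) (\<lambda>p. ennreal (threshold p) * indicator (subgraph (steiner u g)) p) p s \<partial>lborel)"
    by (simp add: * nn_fibre nn_fibre_steiner)
qed simp_all

private lemma emeasure_subgraph: "emeasure lborel (subgraph (steiner u g)) = emeasure lborel (subgraph g)"
  using nn_integral_eq_if_lines[OF _ _ norm_u0, of "indicator (subgraph (steiner u g))" "indicator (subgraph g)"]
  by (simp add: nn_fibre nn_fibre_steiner)

private lemma in_subgraph_steiner_iff:
  assumes "0 < snd p"
  shows "p \<in> subgraph (steiner u g) \<longleftrightarrow> (norm (fst p))\<^sup>2 < threshold p"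
proof -
  have "p \<in> subgraph (steiner u g) \<longleftrightarrow> 2 * \<bar>fst p \<bullet> u\<bar> < fibre_length p"
    using assms steiner_less_iff[OF g u] by (simp add: subgraph_def fibre_length_def)
  also have "\<dots> \<longleftrightarrow> \<bar>fst p \<bullet> u\<bar> < \<bar>fibre_length p / 2\<bar>" using fibre_length_nonneg[of p] by (simp add: field_simps)
  also have "\<dots> \<longleftrightarrow> (fst p \<bullet> u)\<^sup>2 < (fibre_length p / 2)\<^sup>2"
    using abs_le_square_iff[of "fibre_length p / 2" "fst p \<bullet> u"] by (simp add: not_le[symmetric])
  finally show ?thesis by (simp add: threshold_def)
qed

private lemma nn_moment: "k \<in> cc \<Longrightarrow> (\<integral>\<^sup>+p. ennreal ((norm (fst p))\<^sup>2) * indicator (subgraph k) p \<partial>lborel) = ennreal (moment (k :: real^'d \<Rightarrow> real))"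
  unfolding moment_def by (intro nn_integral_subgraph_cc continuous_intros) auto

text \<open>Finiteness allows this integral to be cancelled from both sides of an inequality in
  \<open>ennreal\<close>.\<close>

private lemma nn_threshold_finite: "(\<integral>\<^sup>+p. ennreal (threshold p) * indicator (subgraph g) p \<partial>lborel) < \<infinity>"
proof -
  obtain R where R: "0 \<le> R" "\<And>x. g x \<noteq> 0 \<Longrightarrow> norm x \<le> R" using cc_supportE[OF g] by blast
  have "fibre_length p \<le> 2 * R" for p
  proof (cases "0 < snd p")
    case True
    have "{s. snd p < line u g (fst p) s} \<subseteq> {-R..R}"
    proof
      fix s assume "s \<in> {s. snd p < line u g (fst p) s}"
      then have "g (fst p - (fst p \<bullet> u) *\<^sub>R u + s *\<^sub>R u) \<noteq> 0" using True by (auto simp: line_def)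
      then have "\<bar>s\<bar> \<le> R" using R(2) abs_le_norm_line[OF u, of s "fst p"] by (meson order_trans)
      then show "s \<in> {-R..R}" by auto
    qed
    then have "measure lborel {s. snd p < line u g (fst p) s} \<le> measure lborel {-R..R}"
      using cc_level_open[OF line_cc[OF g u]] by (intro measure_mono_fmeasurable) (auto simp: borel_open fmeasurable_compact)
    then show ?thesis using True R(1) by (simp add: fibre_length_def)
  qed (use R in \<open>simp add: fibre_length_def\<close>)
  then have "(fibre_length p / 2)\<^sup>2 \<le> R\<^sup>2" for p
    using fibre_length_nonneg[of p] by (intro power_mono) (auto simp: field_simps)
  then have "threshold p \<le> R\<^sup>2 + (norm (fst p))\<^sup>2" for p
    unfolding threshold_def by (smt (verit) zero_le_power2)
  then have "(\<integral>\<^sup>+p. ennreal (threshold p) * indicator (subgraph g) p \<partial>lborel)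
     \<le> (\<integral>\<^sup>+p. ennreal (R\<^sup>2 + (norm (fst p))\<^sup>2) * indicator (subgraph g) p \<partial>lborel)"
    by (intro nn_integral_mono mult_right_mono ennreal_leI) auto
  also have "\<dots> < \<infinity>" using g by (subst nn_integral_subgraph_cc) (auto intro!: continuous_intros)
  finally show ?thesis .
qed

text \<open>Comparing the integrals of a difference over two sets is written with sums placed
  crosswise, which avoids truncated subtraction in \<open>ennreal\<close>.\<close>

private lemma exchange:
  "(\<integral>\<^sup>+p. ennreal ((norm (fst p))\<^sup>2) * indicator (subgraph (steiner u g)) p + ennreal (threshold p) * indicator (subgraph g) p \<partial>lborel)
    = ennreal (moment (steiner u g)) + (\<integral>\<^sup>+p. ennreal (threshold p) * indicator (subgraph g) p \<partial>lborel)"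
  "(\<integral>\<^sup>+p. ennreal ((norm (fst p))\<^sup>2) * indicator (subgraph g) p + ennreal (threshold p) * indicator (subgraph (steiner u g)) p \<partial>lborel)
    = ennreal (moment g) + (\<integral>\<^sup>+p. ennreal (threshold p) * indicator (subgraph g) p \<partial>lborel)"
  by (subst nn_integral_add; simp add: nn_moment g Sg nn_threshold)+

text \<open>Only points in exactly one of the two subgraphs matter: there the squared norm is below
  the threshold on the symmetrized side and at least the threshold on the other.\<close>

private lemma exchange_pointwise:
  "ennreal ((norm (fst p))\<^sup>2) * indicator (subgraph (steiner u g)) p + ennreal (threshold p) * indicator (subgraph g) p
   \<le> ennreal ((norm (fst p))\<^sup>2) * indicator (subgraph g) p + ennreal (threshold p) * indicator (subgraph (steiner u g)) p"
proof (cases "0 < snd p")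
  case True
  then show ?thesis using in_subgraph_steiner_iff[OF True]
    by (cases "p \<in> subgraph g"; cases "p \<in> subgraph (steiner u g)") (auto intro: ennreal_leI)
qed (simp add: subgraph_def)

lemma moment_steiner_le: "moment (steiner u g) \<le> moment g"
proof -
  have "ennreal (moment (steiner u g)) + (\<integral>\<^sup>+p. ennreal (threshold p) * indicator (subgraph g) p \<partial>lborel)
    \<le> ennreal (moment g) + (\<integral>\<^sup>+p. ennreal (threshold p) * indicator (subgraph g) p \<partial>lborel)"
    unfolding exchange[symmetric] by (intro nn_integral_mono exchange_pointwise)
  then have "ennreal (moment (steiner u g)) \<le> ennreal (moment g)"
    using nn_threshold_finite by (auto simp: add.commute[of "ennreal (moment _)"] ennreal_add_left_cancel_le)
  then show ?thesis using moment_nonneg[OF g] by simp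
qed

text \<open>Equality of the moments forces equality almost everywhere in
  \<open>exchange_pointwise\<close>, so the subgraphs differ by a null set; continuity removes the
  null set.\<close>

lemma moment_steiner_eqD:
  assumes "moment (steiner u g) = moment g" shows "steiner u g = g"
proof -
  let ?F = "subgraph g" and ?F' = "subgraph (steiner u g)"
  have fin: "emeasure lborel ?F < \<infinity>"
    using nn_integral_subgraph_cc[OF g, of "\<lambda>_. 1"] by simp
  have "AE p in lborel. p \<notin> ?F' - ?F"
  proof (rule ccontr)
    let ?h = "\<lambda>p. ennreal ((norm (fst p))\<^sup>2) * indicator ?F' p + ennreal (threshold p) * indicator ?F p"
    let ?k = "\<lambda>p. ennreal ((norm (fst p))\<^sup>2) * indicator ?F p + ennreal (threshold p) * indicator ?F' p"
    assume neg: "\<not> (AE p in lborel. p \<notin> ?F' - ?F)"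
    have "integral\<^sup>N lborel ?h < integral\<^sup>N lborel ?k"
    proof (rule nn_integral_less)
      show "integral\<^sup>N lborel ?h \<noteq> \<infinity>" unfolding exchange using nn_threshold_finite by auto
      show "AE p in lborel. ?h p \<le> ?k p" using exchange_pointwise by auto
      show "\<not> (AE p in lborel. ?k p \<le> ?h p)"
      proof
        assume "AE p in lborel. ?k p \<le> ?h p"
        then have "AE p in lborel. p \<notin> ?F' - ?F"
        proof eventually_elim
          case (elim p)
          show ?case
          proof
            assume p: "p \<in> ?F' - ?F"
            then have "0 < snd p" by (simp add: subgraph_def)
            with p elim show False using in_subgraph_steiner_iff[of p] by (simp add: not_le[symmetric])
          qed
        qed
        with neg show False ..
      qed
    qed simp_all
    then show False unfolding exchange assms by simp
  qed
  then have 0: "emeasure lborel (?F' - ?F) = 0" by (subst (asm) AE_iff_measurable[of "?F' - ?F"]) auto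
  \<comment> \<open>On this difference the pointwise inequality need not be strict, so the equality
    of the total measures is used instead.\<close>
  have "emeasure lborel (?F - ?F') = 0"
  proof -
    have "emeasure lborel ?F' = emeasure lborel (?F' - ?F) + emeasure lborel (?F' \<inter> ?F)"
      by (subst plus_emeasure) (auto intro!: arg_cong[where f="emeasure lborel"])
    moreover have "emeasure lborel ?F = emeasure lborel (?F - ?F') + emeasure lborel (?F' \<inter> ?F)"
      by (subst plus_emeasure) (auto intro!: arg_cong[where f="emeasure lborel"])
    moreover have "emeasure lborel (?F' \<inter> ?F) \<noteq> \<top>"
      using fin emeasure_mono[of "?F' \<inter> ?F" ?F lborel] by (auto simp: less_top[symmetric] top_unique)
    ultimately show ?thesis using 0 emeasure_subgraph
      by (metis add.commute add_0 ennreal_add_left_cancel infinity_ennreal_def)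
  qed
  have le: "k x \<le> h x" if "emeasure lborel (subgraph k - subgraph h) = 0" "k \<in> cc" "h \<in> cc" for k h :: "real^'d \<Rightarrow> real" and x
  proof (rule ccontr)
    assume "\<not> k x \<le> h x"
    \<comment> \<open>The open region between the two graphs: if nonempty it has positive measure,
      yet it lies in a null set.\<close>
    define W where "W = {p. h (fst p) < snd p \<and> snd p < k (fst p)}"
    have "open W" unfolding W_def
      by (intro open_Collect_conj open_Collect_less continuous_intros continuous_on_compose2[OF cc_continuous[OF that(2)]]
          continuous_on_compose2[OF cc_continuous[OF that(3)]]) auto
    have "(x, (h x + k x) / 2) \<in> W" using \<open>\<not> k x \<le> h x\<close> by (simp add: W_def)
    then have "W \<noteq> {}" by blast
    then have "\<not> negligible W" using \<open>open W\<close> by (intro open_not_negligible)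
    then have "W \<notin> null_sets lborel"
      by (auto simp: negligible_iff_null_sets null_sets_completionI)
    moreover have "W \<subseteq> subgraph k - subgraph h"
      using cc_nonneg[OF that(3)] by (force simp: W_def subgraph_def intro: le_less_trans)
    moreover have "subgraph k - subgraph h \<in> null_sets lborel"
      using that(1) open_subgraph[OF that(2)] open_subgraph[OF that(3)]
      by (auto simp: null_sets_def intro!: sets.Diff borel_open)
    ultimately show False using null_sets_subset[of "subgraph k - subgraph h" lborel W] \<open>open W\<close> by (auto simp: borel_open)
  qed
  show ?thesis using le[OF 0 Sg g] le[OF \<open>emeasure lborel (?F - ?F') = 0\<close> g Sg] by (intro ext antisym)
qed

end

section \<open>Common fixed points and dependence on the direction\<close>

lemma reflection_alt: "reflection u x = x + (- 2 * (x \<bullet> u)) *\<^sub>R u"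
  by (simp add: reflection_def)

text \<open>The reflection keeps the line through \<open>x\<close> and only changes the sign of
  \<open>x \<bullet> u\<close>. Hence a function fixed by the symmetrization is invariant under the
  reflection.\<close>

lemma steiner_reflection:
  assumes "g \<in> cc" "norm u = 1"
  shows "steiner u g (reflection u x) = steiner u g x"
proof (rule eq_if_levels)
  have "reflection u x \<bullet> u = - (x \<bullet> u)"
    using assms(2) by (simp add: reflection_def inner_diff_left norm_eq_1)
  moreover have "line u g (reflection u x) = line u g x"
    unfolding reflection_alt by (rule line_add[OF assms(2)])
  ultimately show "t < steiner u g (reflection u x) \<longleftrightarrow> t < steiner u g x" if "0 < t" for t
    using that by (simp add: steiner_less_iff[OF assms])
qed (simp_all add: steiner_nonneg assms)

text \<open>Radial symmetry alone says nothing about monotonicity. Being fixed along one direction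
  makes the level sets on the axis through the origin centred intervals, and radial symmetry turns
  these into centred balls.\<close>

lemma radial_fixed_eq_rearr:
  fixes g :: "real^'d \<Rightarrow> real"
  assumes g: "g \<in> cc" and u: "norm u = 1" and fixed: "steiner u g = g"
    and radial: "\<And>x y. norm x = norm y \<Longrightarrow> g x = g y"
  shows "rearrangement g = g"
proof
  fix x
  show "rearrangement g x = g x"
  proof (rule eq_if_levels)
    fix t :: real assume t: "0 < t"
    define m where "m = measure lborel {s. t < line u g 0 s}"
    have lev: "t < g y \<longleftrightarrow> norm y < m / 2" for y
    proof -
      have "g y = steiner u g (norm y *\<^sub>R u)" using radial[of y "norm y *\<^sub>R u"] u by (simp add: fixed)
      moreover have "line u g (norm y *\<^sub>R u) = line u g 0" using line_add[OF u, of g 0 "norm y"] by simp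
      ultimately show ?thesis using t u by (simp add: steiner_less_iff[OF g u] m_def norm_eq_1 mult.commute)
    qed
    have "{y. t < g y} = ball 0 (m / 2)" by (auto simp: lev)
    then have "measure lborel {y. t < g y} = unit_ball_vol DIM(real^'d) * (m / 2) ^ DIM(real^'d)"
      by (simp add: content_ball m_def)
    moreover have "norm x < m / 2 \<longleftrightarrow> norm x ^ DIM(real^'d) < (m / 2) ^ DIM(real^'d)"
      using power_mono_iff[of "m / 2" "norm x" "DIM(real^'d)"] by (simp add: not_le[symmetric] m_def)
    moreover have "unit_ball_vol DIM(real^'d) > 0" by simp
    ultimately show "t < rearrangement g x \<longleftrightarrow> t < g x"
      unfolding rearr_less_iff[OF g t] lev by (simp only: mult_less_cancel_left_pos)
  qed (simp_all add: g rearr_nonneg cc_nonneg)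
qed

text \<open>The property of a set of directions through which (a) and (b) share one argument: the
  whole sphere has it, and so does every generating set. Nonemptiness supplies the direction for
  \<open>radial_fixed_eq_rearr\<close>.\<close>

definition determining :: "(real^'d) set \<Rightarrow> bool" where
  "determining G \<longleftrightarrow> G \<subseteq> sphere 0 1 \<and> G \<noteq> {} \<and>
     (\<forall>g\<in>cc. (\<forall>u\<in>G. steiner u g = g) \<longrightarrow> (\<forall>x y. norm x = norm y \<longrightarrow> g x = g y))"

lemma sphere_nonempty: "sphere 0 1 \<noteq> ({} :: (real^'d) set)"
proof -
  have "axis undefined 1 \<in> (sphere 0 1 :: (real^'d) set)" by simp
  then show ?thesis by blast
qed

lemma determining_sphere: "determining (sphere 0 1 :: (real^'d) set)"
  unfolding determining_def
proof (intro conjI ballI impI allI)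
  fix g :: "real^'d \<Rightarrow> real" and x y :: "real^'d"
  assume g: "g \<in> cc" and fixed: "\<forall>u\<in>sphere 0 1. steiner u g = g" and xy: "norm x = norm y"
  show "g x = g y"
  proof (cases "x = y")
    case False
    \<comment> \<open>The reflection along the normalized difference exchanges two points of equal
      norm.\<close>
    define u where "u = (1 / norm (x - y)) *\<^sub>R (x - y)"
    have u: "norm u = 1" using False by (simp add: u_def)
    have "norm (x - y) ^ 2 = 2 * (x \<bullet> (x - y))"
      using xy unfolding power2_norm_eq_inner norm_eq by (simp add: inner_diff inner_commute)
    then have "2 * (x \<bullet> u) = norm (x - y)"
      using False by (simp add: u_def power2_eq_square nonzero_divide_eq_eq)
    then have "(2 * (x \<bullet> u)) *\<^sub>R u = x - y" using False by (simp add: u_def)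
    then have "reflection u x = y" by (simp add: reflection_def)
    then show ?thesis using steiner_reflection[OF g u, of x] fixed u by simp
  qed simp
qed (use sphere_nonempty in auto)

text \<open>The matrices \<open>Q\<close> with \<open>g (Q *v x) = g x\<close> form a closed set
  that contains all reflection products, hence all orthogonal matrices; and these act transitively
  on each centred sphere.\<close>

lemma determining_generating:
  fixes G :: "(real^'d) set"
  assumes "generating_directions G"
  shows "determining G"
  unfolding determining_def
proof (intro conjI ballI impI allI)
  have G: "G \<subseteq> sphere 0 1" "closure (reflection_products G) = {Q. orthogonal_matrix Q}"
    using assms by (auto simp: generating_directions_def)
  show "G \<subseteq> sphere 0 1" by fact
  show "G \<noteq> {}"
  proof
    assume "G = {}"
    then have "{Q. orthogonal_matrix Q} = {mat 1 :: real^'d^'d}"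
      using G(2) by (simp add: reflection_products_def)
    then have *: "Q = mat 1" if "orthogonal_matrix Q" for Q :: "real^'d^'d" using that by blast
    \<comment> \<open>With \<open>G\<close> empty the only product is the identity, but some
      orthogonal map sends \<open>a\<close> to \<open>- a\<close>.\<close>
    define a where "a = (axis undefined 1 :: real^'d)"
    obtain f where f: "orthogonal_transformation f" "f a = - a"
      using orthogonal_transformation_exists[of a "- a"] by auto
    then have "matrix f = mat 1" "matrix f *v a = - a"
      using * by (simp_all add: orthogonal_transformation_matrix matrix_works linear_matrix_vector_mul_eq)
    then have "a = - a" by simp
    from arg_cong[OF this, of "\<lambda>z. z $ undefined"] show False by (simp add: a_def axis_def)
  qed
  fix g :: "real^'d \<Rightarrow> real" and x y :: "real^'d"
  assume g: "g \<in> cc" and fixed: "\<forall>u\<in>G. steiner u g = g" and xy: "norm x = norm y"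
  let ?H = "{Q. g (Q *v x) = g x}"
  have "reflection_products G \<subseteq> ?H"
  proof
    fix Q assume "Q \<in> reflection_products G"
    then obtain us where us: "set us \<subseteq> G" and Q: "Q = foldr (\<lambda>u Q. matrix (reflection u) ** Q) us (mat 1)"
      by (auto simp: reflection_products_def)
    have "g (foldr (\<lambda>u Q. matrix (reflection u) ** Q) us (mat 1) *v x) = g x" using us
    proof (induction us)
      case (Cons u us)
      let ?P = "foldr (\<lambda>u Q. matrix (reflection u) ** Q) us (mat 1)"
      have u: "u \<in> G" "norm u = 1" using Cons.prems G(1) by auto
      have "linear (reflection u)"
        unfolding reflection_def by (intro linearI) (simp_all add: inner_left_distrib algebra_simps)
      then have "matrix (reflection u) *v z = reflection u z" for z
        by (simp add: matrix_works linear_matrix_vector_mul_eq)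
      then have "g ((matrix (reflection u) ** ?P) *v x) = g (reflection u (?P *v x))"
        by (simp add: matrix_vector_mul_assoc[symmetric])
      also have "\<dots> = g (?P *v x)"
        using steiner_reflection[OF g u(2)] fixed u(1) by simp
      finally show ?case using Cons by simp
    qed simp
    then show "Q \<in> ?H" by (simp add: Q)
  qed
  moreover have "continuous_on UNIV (\<lambda>Q::real^'d^'d. Q *v x)"
    unfolding matrix_vector_mult_def by (intro continuous_on_vec_lambda continuous_intros)
  then have "closed ?H"
    by (intro closed_Collect_eq continuous_on_const continuous_on_compose2[OF cc_continuous[OF g]]) auto
  ultimately have "closure (reflection_products G) \<subseteq> ?H" by (rule closure_minimal)
  then have H: "g (Q *v x) = g x" if "orthogonal_matrix Q" for Q using that G(2) by auto
  obtain f where f: "orthogonal_transformation f" "f x = y" using orthogonal_transformation_exists[OF xy] by blast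
  then have "matrix f *v x = y" "orthogonal_matrix (matrix f)"
    by (simp_all add: orthogonal_transformation_matrix matrix_works linear_matrix_vector_mul_eq)
  then show "g x = g y" using H by metis
qed

section \<open>Continuity of the moment, and of symmetrization in function and direction\<close>

lemma moment_diff_le:
  fixes g h :: "'a::euclidean_space \<Rightarrow> real"
  assumes "g \<in> cc" "h \<in> cc" "\<And>x. g x \<noteq> 0 \<Longrightarrow> norm x \<le> R" "\<And>x. h x \<noteq> 0 \<Longrightarrow> norm x \<le> R"
    and "\<And>x. \<bar>g x - h x\<bar> \<le> e"
  shows "\<bar>moment g - moment h\<bar> \<le> e * (R\<^sup>2 * measure lborel (cball (0::'a) R))"
proof -
  have e: "0 \<le> e" using assms(5)[of 0] by linarith
  have ig: "integrable lborel (\<lambda>x. (norm x)\<^sup>2 * g x)" and ih: "integrable lborel (\<lambda>x. (norm x)\<^sup>2 * h x)"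
    by (intro integrable_cc assms continuous_intros)+
  have "moment g - moment h = (LINT x|lborel. (norm x)\<^sup>2 * g x - (norm x)\<^sup>2 * h x)"
    unfolding moment_def using ig ih by simp
  then have "\<bar>moment g - moment h\<bar> \<le> (LINT x|lborel. norm ((norm x)\<^sup>2 * g x - (norm x)\<^sup>2 * h x))"
    using integral_norm_bound[of lborel "\<lambda>x. (norm x)\<^sup>2 * g x - (norm x)\<^sup>2 * h x"] by simp
  also have "\<dots> \<le> (LINT x|lborel. (R\<^sup>2 * e) * indicator (cball (0::'a) R) x)"
  proof (rule Bochner_Integration.integral_mono)
    show "integrable lborel (\<lambda>x. norm ((norm x)\<^sup>2 * g x - (norm x)\<^sup>2 * h x))" using ig ih by simp
    show "integrable lborel (\<lambda>x::'a. (R\<^sup>2 * e) * indicator (cball 0 R) x)"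
      using emeasure_bounded_finite[of "cball (0::'a) R"] by (intro integrable_mult_right) simp
    fix x :: 'a
    have "norm ((norm x)\<^sup>2 * g x - (norm x)\<^sup>2 * h x) = (norm x)\<^sup>2 * \<bar>g x - h x\<bar>"
      by (simp add: right_diff_distrib[symmetric] abs_mult)
    also have "\<dots> \<le> (R\<^sup>2 * e) * indicator (cball 0 R) x"
    proof (cases "norm x \<le> R")
      case True
      then show ?thesis using assms(5)[of x] by (simp add: mult_mono power_mono)
    next
      case False
      then have "g x = 0" "h x = 0" using assms(3,4)[of x] by blast+
      then show ?thesis using False by simp
    qed
    finally show "norm ((norm x)\<^sup>2 * g x - (norm x)\<^sup>2 * h x) \<le> (R\<^sup>2 * e) * indicator (cball 0 R) x" .
  qed
  also have "\<dots> = e * (R\<^sup>2 * measure lborel (cball (0::'a) R))" by simp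
  finally show ?thesis .
qed

lemma moment_tendsto:
  assumes "\<And>n. g n \<in> cc" "h \<in> cc" "\<And>n x. g n x \<noteq> 0 \<Longrightarrow> norm x \<le> R" "\<And>x. h x \<noteq> 0 \<Longrightarrow> norm x \<le> R"
    and lim: "uniform_limit UNIV g h sequentially"
  shows "(\<lambda>n. moment (g n)) \<longlonglongrightarrow> moment h"
proof (rule LIMSEQ_I)
  fix r :: real assume r: "0 < r"
  define C where "C = R\<^sup>2 * measure lborel (cball (0::'a) R)"
  have C: "0 \<le> C" by (simp add: C_def)
  \<comment> \<open>The summand 1 covers the case that \<open>C\<close> vanishes.\<close>
  define e where "e = r / (C + 1)"
  have e: "0 < e" "e * C < r" using r C by (auto simp: e_def field_simps)
  obtain N where N: "\<And>n x. n \<ge> N \<Longrightarrow> dist (g n x) (h x) < e"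
    using lim e(1) unfolding uniform_limit_sequentially_iff by blast
  have "norm (moment (g n) - moment h) < r" if "n \<ge> N" for n
    using moment_diff_le[OF assms(1,2,3,4), where e=e] N[OF that] e(2)
    unfolding C_def dist_real_def real_norm_def by (meson le_less_trans less_imp_le)
  then show "\<exists>N. \<forall>n\<ge>N. norm (moment (g n) - moment h) < r" by blast
qed

text \<open>Points on the lines through \<open>x\<close> in the directions \<open>u\<close> and \<open>v\<close> with the same parameter
  \<open>s\<close> are at distance at most \<open>(norm x + \<bar>s\<bar>) * norm (u - v)\<close>; the remaining error comes from
  the different parameters of \<open>x\<close> itself.\<close>
lemma steiner_direction_le:
  fixes g :: "real^'d \<Rightarrow> real"
  assumes g: "g \<in> cc" and u: "norm u = 1" and v: "norm v = 1"
    and supp: "\<And>x. g x \<noteq> 0 \<Longrightarrow> norm x \<le> R" and R: "0 \<le> R"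
    and osc: "osc \<eta> e g" and e: "0 \<le> e" and uv: "3 * R * norm (u - v) \<le> \<eta>"
  shows "steiner v g x \<le> steiner u g x + 2 * e"
proof (cases "norm x \<le> R")
  case True
  have "0 \<le> 3 * R * norm (u - v)" using R by simp
  then have \<eta>: "0 \<le> \<eta>" using uv by linarith
  have xuv: "\<bar>x \<bullet> (u - v)\<bar> \<le> R * norm (u - v)"
    using Cauchy_Schwarz_ineq2[of x "u - v"] mult_right_mono[OF True, of "norm (u - v)"] by simp
  \<comment> \<open>The point of the line through \<open>x\<close> along \<open>u\<close> whose
    parameter is \<open>x \<bullet> v\<close>. Passing through it separates the change of line from
    the change of parameter; each costs \<open>e\<close>.\<close>
  define y where "y = x + (x \<bullet> v - x \<bullet> u) *\<^sub>R u"
  have yu: "y \<bullet> u = x \<bullet> v" using u by (simp add: y_def inner_left_distrib norm_eq_1)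
  have ly: "line u g y = line u g x" unfolding y_def by (rule line_add[OF u])
  have "steiner v g x \<le> steiner u g y + e"
  proof (rule le_add_if_levels)
    fix t :: real assume t: "0 < t" "t + e < steiner v g x"
    have "measure lborel {s. t + e < line v g x s} \<le> measure lborel {s. t < line u g x s}"
    proof (rule measure_level_mono)
      fix s assume s: "t + e < line v g x s"
      then have "g (x - (x \<bullet> v) *\<^sub>R v + s *\<^sub>R v) \<noteq> 0" using t e by (auto simp: line_def)
      then have "norm (x - (x \<bullet> v) *\<^sub>R v + s *\<^sub>R v) \<le> R" by (rule supp)
      then have sR: "\<bar>s\<bar> \<le> R" using abs_le_norm_line[OF v, of s x] by linarith
      have "norm ((s - x \<bullet> v) *\<^sub>R (v - u) + (x \<bullet> (u - v)) *\<^sub>R u)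
          \<le> \<bar>s - x \<bullet> v\<bar> * norm (v - u) + \<bar>x \<bullet> (u - v)\<bar>"
        using norm_triangle_ineq[of "(s - x \<bullet> v) *\<^sub>R (v - u)" "(x \<bullet> (u - v)) *\<^sub>R u"] u by simp
      \<comment> \<open>The two terms add up to the factor \<open>3 * R\<close> in the hypothesis on
        \<open>u\<close> and \<open>v\<close>.\<close>
      also have "\<dots> \<le> 2 * R * norm (v - u) + R * norm (u - v)"
      proof (intro add_mono mult_right_mono xuv)
        have "\<bar>x \<bullet> v\<bar> \<le> R" using Cauchy_Schwarz_ineq2[of x v] v True by simp
        then show "\<bar>s - x \<bullet> v\<bar> \<le> 2 * R" using sR by linarith
      qed simp
      also have "\<dots> \<le> \<eta>" using uv by (simp add: norm_minus_commute)
      finally have "norm ((x - (x \<bullet> v) *\<^sub>R v + s *\<^sub>R v) - (x - (x \<bullet> u) *\<^sub>R u + s *\<^sub>R u)) \<le> \<eta>"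
        by (simp add: inner_diff_right algebra_simps)
      then have "line v g x s \<le> line u g x s + e" using osc by (auto simp: osc_def line_def)
      then show "t < line u g x s" using s by linarith
    qed (use g u v t e in \<open>auto intro: line_cc\<close>)
    then show "t < steiner u g y"
      using t e steiner_less_iff[OF g v, of "t + e" x] steiner_less_iff[OF g u, of t y] by (simp add: yu ly)
  qed (use g u steiner_nonneg in auto)
  also have "steiner u g y \<le> steiner u g x + e"
  proof -
    have "norm (y - x) = \<bar>x \<bullet> (u - v)\<bar>" using u by (simp add: y_def inner_diff_right abs_minus_commute)
    also have "\<dots> \<le> \<eta>" using xuv uv R mult_nonneg_nonneg[OF R norm_ge_zero[of "u - v"]] by linarith
    finally show ?thesis using steiner_osc[OF g u osc \<eta>] by (simp add: osc_def)
  qed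
  finally show ?thesis by simp
next
  case False
  then have "steiner v g x = 0" using steiner_support[OF g v supp R] by blast
  then show ?thesis using steiner_nonneg[OF g u, of x] e by simp
qed

text \<open>Replacing \<open>g n\<close> by \<open>h\<close> is controlled by nonexpansiveness, and
  replacing \<open>v n\<close> by \<open>u\<close> by a modulus of continuity of
  \<open>h\<close>.\<close>

lemma steiner_uniform_limit:
  fixes g :: "nat \<Rightarrow> real^'d \<Rightarrow> real"
  assumes g: "\<And>n. g n \<in> cc" and h: "h \<in> cc" and v: "\<And>n. norm (v n) = 1" and u: "norm u = 1"
    and vu: "v \<longlonglongrightarrow> u" and gh: "uniform_limit UNIV g h sequentially"
  shows "uniform_limit UNIV (\<lambda>n. steiner (v n) (g n)) (steiner u h) sequentially"
  unfolding uniform_limit_sequentially_iff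
proof (intro allI impI)
  fix e :: real assume e: "0 < e"
  obtain R where R: "0 \<le> R" "\<And>x. h x \<noteq> 0 \<Longrightarrow> norm x \<le> R" using cc_supportE[OF h] by blast
  \<comment> \<open>The change of direction costs twice \<open>e/4\<close> and the change of
    function another \<open>e/4\<close>, which leaves a strict margin below
    \<open>e\<close>.\<close>
  obtain \<eta> where \<eta>: "0 < \<eta>" "osc \<eta> (e/4) h" using cc_osc[OF h, of "e/4"] e by auto
  define d where "d = \<eta> / (3 * R + 1)"
  have d: "0 < d" "3 * R * d \<le> \<eta>" using \<eta>(1) R(1) by (auto simp: d_def field_simps)
  obtain N1 where N1: "\<And>n. n \<ge> N1 \<Longrightarrow> norm (v n - u) < d" using LIMSEQ_D[OF vu d(1)] by auto
  have "0 < e/4" using e by simp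
  then obtain N2 where N2: "\<And>n x. n \<ge> N2 \<Longrightarrow> dist (g n x) (h x) < e/4"
    using gh unfolding uniform_limit_sequentially_iff by blast
  have "dist (steiner (v n) (g n) x) (steiner u h x) < e" if n: "n \<ge> max N1 N2" for n x
  proof -
    have "norm (v n - u) \<le> d" using N1[of n] n by simp
    then have "3 * R * norm (v n - u) \<le> \<eta>" using R(1) d(2) mult_left_mono[of "norm (v n - u)" d "3 * R"] by linarith
    then have uv: "3 * R * norm (u - v n) \<le> \<eta>" "3 * R * norm (v n - u) \<le> \<eta>" by (simp_all add: norm_minus_commute)
    have a: "steiner (v n) h x \<le> steiner u h x + 2 * (e/4)" "steiner u h x \<le> steiner (v n) h x + 2 * (e/4)"
      using steiner_direction_le[OF h u v R(2,1) \<eta>(2) _ uv(1)] steiner_direction_le[OF h v u R(2,1) \<eta>(2) _ uv(2)] e by auto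
    have "\<bar>g n y - h y\<bar> < e/4" for y using N2[of n y] n by (simp add: dist_real_def)
    then have le: "g n y \<le> h y + e/4" "h y \<le> g n y + e/4" for y by (smt (verit))+
    have "steiner (v n) (g n) x \<le> steiner (v n) h x + e/4" "steiner (v n) h x \<le> steiner (v n) (g n) x + e/4"
      by (intro steiner_le_add g h v le; use e in simp)+
    then show ?thesis using a e unfolding dist_real_def by linarith
  qed
  then show "\<exists>N. \<forall>n\<ge>N. \<forall>x\<in>UNIV. dist (steiner (v n) (g n) x) (steiner u h x) < e" by blast
qed

section \<open>Compactness\<close>

definition steiner_class :: "(real^'d \<Rightarrow> real) \<Rightarrow> real \<Rightarrow> (real^'d \<Rightarrow> real) set" where
  "steiner_class f R = {g \<in> cc. (\<forall>x. g x \<noteq> 0 \<longrightarrow> norm x \<le> R) \<and>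
     (\<forall>\<eta> e. 0 \<le> \<eta> \<longrightarrow> osc \<eta> e f \<longrightarrow> osc \<eta> e g) \<and> rearrangement g = rearrangement f}"

lemma steiner_class_cc: "g \<in> steiner_class f R \<Longrightarrow> g \<in> cc"
  and steiner_class_support: "g \<in> steiner_class f R \<Longrightarrow> g x \<noteq> 0 \<Longrightarrow> norm x \<le> R"
  and steiner_class_osc: "g \<in> steiner_class f R \<Longrightarrow> 0 \<le> \<eta> \<Longrightarrow> osc \<eta> e f \<Longrightarrow> osc \<eta> e g"
  and steiner_class_rearr: "g \<in> steiner_class f R \<Longrightarrow> rearrangement g = rearrangement f"
  by (auto simp: steiner_class_def)

lemma steiner_class_self: "f \<in> cc \<Longrightarrow> (\<And>x. f x \<noteq> 0 \<Longrightarrow> norm x \<le> R) \<Longrightarrow> f \<in> steiner_class f R"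
  by (auto simp: steiner_class_def)

lemma steiner_in_class:
  assumes "g \<in> steiner_class f R" "norm u = 1" "0 \<le> R"
  shows "steiner u g \<in> steiner_class f R"
proof -
  have g: "g \<in> cc" using assms(1) by (rule steiner_class_cc)
  show ?thesis unfolding steiner_class_def
    using steiner_cc[OF g assms(2)] steiner_support[OF g assms(2) steiner_class_support[OF assms(1)] assms(3)]
      steiner_osc[OF g assms(2) steiner_class_osc[OF assms(1)]] rearr_steiner[OF g assms(2)] steiner_class_rearr[OF assms(1)]
    by auto
qed

lemma rearr_close:
  assumes "f \<in> cc" "g \<in> cc" "\<And>x. \<bar>f x - g x\<bar> \<le> e"
  shows "\<bar>rearrangement f x - rearrangement g x\<bar> \<le> e"
proof -
  have "0 \<le> e" using assms(3)[of 0] by linarith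
  moreover have "f x \<le> g x + e" "g x \<le> f x + e" for x using assms(3)[of x] by linarith+
  ultimately have "rearrangement f x \<le> rearrangement g x + e" "rearrangement g x \<le> rearrangement f x + e"
    by (auto intro: rearr_le_add assms)
  then show ?thesis by linarith
qed

lemma steiner_close:
  assumes "f \<in> cc" "g \<in> cc" "norm u = 1" "\<And>x. \<bar>f x - g x\<bar> \<le> e"
  shows "\<bar>steiner u f x - steiner u g x\<bar> \<le> e"
  unfolding steiner_line using assms by (intro rearr_close line_cc) (auto simp: line_def)

lemma steiner_class_compact:
  assumes f: "f \<in> cc" and R: "0 \<le> R" and g: "\<And>n. g n \<in> steiner_class f R"
  obtains h k where "h \<in> steiner_class f R" "strict_mono (k :: nat \<Rightarrow> nat)"
    "uniform_limit UNIV (g \<circ> k) h sequentially"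
proof -
  obtain B where B: "\<And>x. f x \<le> B" using cc_bounded[OF f] by blast
  have gcc: "g n \<in> cc" for n using g by (rule steiner_class_cc)
  obtain h0 and k :: "nat \<Rightarrow> nat" where k: "strict_mono k"
    and lim: "\<And>e. 0 < e \<Longrightarrow> \<exists>N. \<forall>n x. n \<ge> N \<and> x \<in> cball 0 R \<longrightarrow> norm (g (k n) x - h0 x) < e"
  proof (rule Arzela_Ascoli[of "cball 0 R" g B])
    show "norm (g n x) \<le> B" for n x
    proof -
      \<comment> \<open>A point where all members of the class vanish. The bound \<open>B\<close> of
        \<open>f\<close> is also a bound on its oscillation at every distance; the class inherits
        it, and comparison with \<open>y\<close> yields the uniform bound.\<close>
      define y :: "real^'a" where "y = (R + 1) *\<^sub>R axis undefined 1"
      have "osc (norm (x - y)) B f" using B cc_nonneg[OF f] unfolding osc_def by (meson add_increasing)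
      then have "osc (norm (x - y)) B (g n)" by (rule steiner_class_osc[OF g norm_ge_zero])
      moreover have "norm y = R + 1" using R by (simp add: y_def)
      then have "g n y = 0" using steiner_class_support[OF g, of n y] by force
      ultimately have "g n x \<le> 0 + B" unfolding osc_def by (metis order_refl)
      then show ?thesis using cc_nonneg[OF gcc, of n x] by simp
    qed
    show "\<exists>d>0. \<forall>n y. y \<in> cball 0 R \<and> norm (x - y) < d \<longrightarrow> norm (g n x - g n y) < e" if e: "0 < e" for x and e :: real
    proof -
      obtain \<eta> where \<eta>: "0 < \<eta>" "osc \<eta> (e/2) f" using cc_osc[OF f, of "e/2"] e by auto
      have "norm (g n x - g n y) < e" if "norm (x - y) < \<eta>" for n y
      proof -
        have "osc \<eta> (e/2) (g n)" using steiner_class_osc[OF g] \<eta> by simp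
        moreover have "norm (x - y) \<le> \<eta>" "norm (y - x) \<le> \<eta>" using that by (simp_all add: norm_minus_commute)
        ultimately have "g n x \<le> g n y + e/2" "g n y \<le> g n x + e/2" by (auto simp: osc_def)
        then show ?thesis using \<open>0 < e\<close> by (simp add: abs_less_iff)
      qed
      then show ?thesis using \<eta>(1) by blast
    qed
  qed (auto simp: that)
  \<comment> \<open>The theorem controls \<open>h0\<close> only on the ball; outside it every
    \<open>g n\<close> vanishes, so extension by zero makes the convergence uniform
    everywhere.\<close>
  define h where "h x = (if norm x \<le> R then h0 x else 0)" for x
  have ulim: "uniform_limit UNIV (g \<circ> k) h sequentially"
    unfolding uniform_limit_sequentially_iff
  proof (intro allI impI)
    fix e :: real assume e: "0 < e"
    obtain N where N: "\<forall>n x. n \<ge> N \<and> x \<in> cball 0 R \<longrightarrow> norm (g (k n) x - h0 x) < e" using lim[OF e] by blast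
    have "dist ((g \<circ> k) n x) (h x) < e" if "n \<ge> N" for n x
    proof (cases "norm x \<le> R")
      case True then show ?thesis using N that by (simp add: h_def dist_norm)
    next
      case False
      then have "g (k n) x = 0" using steiner_class_support[OF g] by blast
      then show ?thesis using False e by (simp add: h_def)
    qed
    then show "\<exists>N. \<forall>n\<ge>N. \<forall>x\<in>UNIV. dist ((g \<circ> k) n x) (h x) < e" by blast
  qed
  have ptw: "(\<lambda>n. g (k n) x) \<longlonglongrightarrow> h x" for x
    using tendsto_uniform_limitI[OF ulim, of x] by simp
  have osc: "osc \<eta> e h" if "0 \<le> \<eta>" "osc \<eta> e f" for \<eta> e
    unfolding osc_def
  proof (intro allI impI)
    fix x y :: "real^'a" assume "norm (x - y) \<le> \<eta>"
    then have "g (k n) x \<le> g (k n) y + e" for n using steiner_class_osc[OF g that] by (auto simp: osc_def)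
    then show "h x \<le> h y + e"
      by (intro LIMSEQ_le[OF ptw tendsto_add[OF ptw tendsto_const]]) auto
  qed
  have "continuous_on UNIV h"
    using cc_osc[OF f] osc by (intro osc_continuous) (meson less_imp_le)
  moreover have "0 \<le> h x" for x
    using cc_nonneg[OF gcc] by (intro LIMSEQ_le_const[OF ptw]) auto
  moreover have supp: "norm x \<le> R" if "h x \<noteq> 0" for x using that by (auto simp: h_def split: if_splits)
  ultimately have hcc: "h \<in> cc" by (auto simp: cc_def)
  have "rearrangement h x = rearrangement f x" for x
  proof (rule ccontr)
    assume neq: "rearrangement h x \<noteq> rearrangement f x"
    define e where "e = \<bar>rearrangement h x - rearrangement f x\<bar> / 2"
    have e: "0 < e" using neq by (simp add: e_def)
    then obtain N where N: "\<And>y. dist ((g \<circ> k) N y) (h y) < e"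
      using ulim unfolding uniform_limit_sequentially_iff by blast
    have "\<bar>rearrangement h x - rearrangement (g (k N)) x\<bar> \<le> e"
      using N by (intro rearr_close hcc gcc) (simp add: dist_real_def abs_minus_commute less_imp_le)
    then have "\<bar>rearrangement h x - rearrangement f x\<bar> \<le> e" by (simp add: steiner_class_rearr[OF g])
    then show False using e by (simp add: e_def)
  qed
  then have "h \<in> steiner_class f R"
    using hcc supp osc by (auto simp: steiner_class_def)
  then show ?thesis using that k ulim by blast
qed

lemma fixed_imp_eq_rearr:
  assumes "g \<in> steiner_class f R" "determining G" "\<And>u. u \<in> G \<Longrightarrow> steiner u g = g"
  shows "g = rearrangement f"
proof -
  have g: "g \<in> cc" using assms(1) by (rule steiner_class_cc)
  obtain u where u: "u \<in> G" using assms(2) by (auto simp: determining_def)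
  then have u1: "norm u = 1" using assms(2) by (auto simp: determining_def)
  have "g x = g y" if "norm x = norm y" for x y
    using assms(2,3) g that unfolding determining_def by blast
  then have "rearrangement g = g"
    by (rule radial_fixed_eq_rearr[OF g u1 assms(3)[OF u]])
  then show ?thesis using steiner_class_rearr[OF assms(1)] by simp
qed

text \<open>The moment attains its minimum on the compact class, and a minimizer is fixed by all
  symmetrizations. Thus the rearrangement is itself in the class; in particular it is continuous.\<close>
lemma rearr_in_steiner_class:
  fixes f :: "real^'d \<Rightarrow> real"
  assumes f: "f \<in> cc" and R: "0 \<le> R" "\<And>x. f x \<noteq> 0 \<Longrightarrow> norm x \<le> R"
  shows "rearrangement f \<in> steiner_class f R" (is "_ \<in> ?K")
    and "norm u = 1 \<Longrightarrow> steiner u (rearrangement f) = rearrangement f"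
proof -
  define m where "m = Inf (moment ` ?K)"
  have bdd: "bdd_below (moment ` ?K)"
    by (rule bdd_belowI[of _ 0]) (auto intro: moment_nonneg steiner_class_cc)
  have m: "m \<le> moment g" if "g \<in> ?K" for g unfolding m_def using that bdd by (intro cInf_lower) auto
  have ne: "moment ` ?K \<noteq> {}" using steiner_class_self[OF f R(2)] by blast
  have "\<exists>g. g \<in> ?K \<and> moment g < m + 1 / real (Suc n)" for n
    using cInf_lessD[OF ne, of "m + 1 / real (Suc n)"] by (auto simp: m_def)
  then have "\<exists>g. \<forall>n. g n \<in> ?K \<and> moment (g n) < m + 1 / real (Suc n)" by (intro choice allI)
  then obtain g where g: "\<And>n. g n \<in> ?K" "\<And>n. moment (g n) < m + 1 / real (Suc n)" by blast
  obtain h k where hk: "h \<in> ?K" "strict_mono (k :: nat \<Rightarrow> nat)" "uniform_limit UNIV (g \<circ> k) h sequentially"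
    by (rule steiner_class_compact[OF f R(1) g(1)])
  have "(\<lambda>n. moment ((g \<circ> k) n)) \<longlonglongrightarrow> moment h"
    using steiner_class_support[OF g(1)] steiner_class_support[OF hk(1)] steiner_class_cc[OF g(1)]
    by (intro moment_tendsto[OF _ steiner_class_cc[OF hk(1)] _ _ hk(3), of R]) auto
  moreover have "(\<lambda>n. m + 1 / real (Suc (k n))) \<longlonglongrightarrow> m"
    using LIMSEQ_subseq_LIMSEQ[OF tendsto_add[OF tendsto_const LIMSEQ_Suc[OF lim_1_over_n]] hk(2), of m] by (simp add: o_def)
  ultimately have "moment h \<le> m"
    by (rule LIMSEQ_le) (use g(2) in \<open>auto intro: less_imp_le\<close>)
  then have fixed: "steiner v h = h" if "norm v = 1" for v
    using moment_steiner_eqD[OF steiner_class_cc[OF hk(1)] that] m[OF steiner_in_class[OF hk(1) that R(1)]]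
      moment_steiner_le[OF steiner_class_cc[OF hk(1)] that] by linarith
  then have "h = rearrangement f"
    using fixed_imp_eq_rearr[OF hk(1) determining_sphere] by simp
  then show "rearrangement f \<in> ?K" "norm u = 1 \<Longrightarrow> steiner u (rearrangement f) = rearrangement f"
    using hk(1) fixed by auto
qed

text \<open>Otherwise take for \<open>T\<close> the first \<open>n + 1\<close> points of a dense
  sequence in \<open>G\<close>, and \<open>1 / (n + 1)\<close> for both \<open>\<delta>\<close> and
  \<open>\<rho>\<close>. A limit \<open>h\<close> of the resulting counterexamples loses no moment
  along any point of the sequence, so by density it is fixed along all of \<open>G\<close> and
  equals \<open>rearrangement f\<close>, although it stays \<open>\<epsilon>\<close>-far from
  it.\<close>

lemma uniform_moment_gap:
  fixes f :: "real^'d \<Rightarrow> real"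
  assumes f: "f \<in> cc" and R: "0 \<le> R" "\<And>x. f x \<noteq> 0 \<Longrightarrow> norm x \<le> R" and G: "determining G" and \<epsilon>: "0 < \<epsilon>"
  shows "\<exists>T \<delta> \<rho>. finite T \<and> T \<noteq> {} \<and> T \<subseteq> G \<and> 0 < \<delta> \<and> 0 < \<rho> \<and>
    (\<forall>g x. g \<in> steiner_class f R \<longrightarrow> \<epsilon> \<le> \<bar>g x - rearrangement f x\<bar> \<longrightarrow>
       (\<exists>u\<in>T. \<forall>v. norm v = 1 \<and> norm (v - u) < \<rho> \<longrightarrow> moment (steiner v g) \<le> moment g - \<delta>))"
proof (rule ccontr)
  assume contra: "\<not> ?thesis"
  obtain D where D: "countable D" "D \<subseteq> G" "G \<subseteq> closure D" using separable[of G] by blast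
  have "D \<noteq> {}" using D(3) G by (auto simp: determining_def)
  define d where "d = from_nat_into D"
  have d: "d n \<in> D" for n unfolding d_def using \<open>D \<noteq> {}\<close> by (rule from_nat_into)
  have d_norm: "norm (d n) = 1" for n using d[of n] D(2) G by (auto simp: determining_def)
  have "\<exists>g x. g \<in> steiner_class f R \<and> \<epsilon> \<le> \<bar>g x - rearrangement f x\<bar> \<and>
     (\<forall>u\<in>d ` {..n}. \<exists>v. norm v = 1 \<and> norm (v - u) < 1 / real (Suc n) \<and> \<not> moment (steiner v g) \<le> moment g - 1 / real (Suc n))" for n
  proof (rule ccontr)
    assume neg: "\<not> ?thesis"
    have "finite (d ` {..n})" "d ` {..n} \<noteq> {}" "d ` {..n} \<subseteq> G" "0 < 1 / real (Suc n)"
      using d D(2) by auto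
    moreover have "\<forall>g x. g \<in> steiner_class f R \<longrightarrow> \<epsilon> \<le> \<bar>g x - rearrangement f x\<bar> \<longrightarrow>
       (\<exists>u\<in>d ` {..n}. \<forall>v. norm v = 1 \<and> norm (v - u) < 1 / real (Suc n) \<longrightarrow> moment (steiner v g) \<le> moment g - 1 / real (Suc n))"
      using neg by blast
    ultimately show False using contra by blast
  qed
  then obtain g x where g: "\<And>n. g n \<in> steiner_class f R" "\<And>n. \<epsilon> \<le> \<bar>g n (x n) - rearrangement f (x n)\<bar>"
    and "\<forall>n. \<forall>u\<in>d ` {..n}. \<exists>v. norm v = 1 \<and> norm (v - u) < 1 / real (Suc n) \<and> \<not> moment (steiner v (g n)) \<le> moment (g n) - 1 / real (Suc n)"
    by metis
  then have "\<forall>n j. \<exists>v. j \<le> n \<longrightarrow> norm v = 1 \<and> norm (v - d j) < 1 / real (Suc n) \<and> moment (g n) - 1 / real (Suc n) < moment (steiner v (g n))"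
    by (auto simp: not_le)
  \<comment> \<open>\<open>v n j\<close> is a direction near \<open>d j\<close> along which the
    \<open>n\<close>-th counterexample loses too little.\<close>
  then obtain v where v: "\<And>n j. j \<le> n \<Longrightarrow> norm (v n j) = 1 \<and> norm (v n j - d j) < 1 / real (Suc n) \<and> moment (g n) - 1 / real (Suc n) < moment (steiner (v n j) (g n))"
    by metis
  have gcc: "g n \<in> cc" for n using g(1) by (rule steiner_class_cc)
  obtain h k where hk: "h \<in> steiner_class f R" "strict_mono (k :: nat \<Rightarrow> nat)" "uniform_limit UNIV (g \<circ> k) h sequentially"
    by (rule steiner_class_compact[OF f R(1) g(1)])
  have hcc: "h \<in> cc" using hk(1) by (rule steiner_class_cc)
  have inv: "(\<lambda>n. 1 / real (Suc (k n))) \<longlonglongrightarrow> 0"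
    using LIMSEQ_subseq_LIMSEQ[OF LIMSEQ_Suc[OF lim_1_over_n] hk(2)] by (simp add: o_def)
  have fixed_d: "steiner (d j) h = h" for j
  proof -
    \<comment> \<open>Shifting the subsequence by \<open>j\<close> guarantees that
      \<open>d j\<close> is among the directions tested by each of its terms.\<close>
    have kj: "j \<le> k (n + j)" for n using seq_suble[OF hk(2), of "n + j"] by linarith
    define w where "w n = v (k (n + j)) j" for n
    define gg where "gg n = g (k (n + j))" for n
    have w: "norm (w n) = 1" "norm (w n - d j) < 1 / real (Suc (k (n + j)))"
        "moment (gg n) - 1 / real (Suc (k (n + j))) < moment (steiner (w n) (gg n))" for n
      using v[OF kj[of n]] by (auto simp: w_def gg_def)
    have inv': "(\<lambda>n. 1 / real (Suc (k (n + j)))) \<longlonglongrightarrow> 0" using LIMSEQ_ignore_initial_segment[OF inv] .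
    have "(\<lambda>n. w n - d j) \<longlonglongrightarrow> 0"
      by (rule Lim_null_comparison[OF _ inv']) (intro always_eventually allI less_imp_le w(2))
    then have wd: "w \<longlonglongrightarrow> d j" by (simp add: LIM_zero_iff)
    have ugg: "uniform_limit UNIV gg h sequentially"
      unfolding uniform_limit_sequentially_iff
    proof (intro allI impI)
      fix e :: real assume "0 < e"
      then obtain N where "\<forall>n\<ge>N. \<forall>x\<in>UNIV. dist ((g \<circ> k) n x) (h x) < e"
        using hk(3) unfolding uniform_limit_sequentially_iff by blast
      then show "\<exists>N. \<forall>n\<ge>N. \<forall>x\<in>UNIV. dist (gg n x) (h x) < e" by (auto simp: gg_def intro!: exI[of _ N])
    qed
    have gcls: "gg n \<in> steiner_class f R" for n using g(1) by (simp add: gg_def)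
    have scls: "steiner (w n) (gg n) \<in> steiner_class f R" for n using steiner_in_class[OF gcls w(1) R(1)] .
    have hcls: "steiner (d j) h \<in> steiner_class f R" by (rule steiner_in_class[OF hk(1) d_norm R(1)])
    have m1: "(\<lambda>n. moment (gg n)) \<longlonglongrightarrow> moment h"
      by (rule moment_tendsto[OF steiner_class_cc[OF gcls] hcc steiner_class_support[OF gcls] steiner_class_support[OF hk(1)] ugg])
    have m2: "(\<lambda>n. moment (steiner (w n) (gg n))) \<longlonglongrightarrow> moment (steiner (d j) h)"
      by (rule moment_tendsto[OF steiner_class_cc[OF scls] steiner_class_cc[OF hcls] steiner_class_support[OF scls] steiner_class_support[OF hcls]
          steiner_uniform_limit[OF steiner_class_cc[OF gcls] hcc w(1) d_norm wd ugg]])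
    have "moment h - 0 \<le> moment (steiner (d j) h)"
      by (rule LIMSEQ_le[OF tendsto_diff[OF m1 inv'] m2]) (use w(3) in \<open>auto intro: less_imp_le\<close>)
    then show ?thesis using moment_steiner_eqD[OF hcc d_norm] moment_steiner_le[OF hcc d_norm, of j] by simp
  qed
  have "steiner u h = h" if "u \<in> G" for u
  proof -
    have "u \<in> closure D" using that D(3) by blast
    then obtain z where z: "\<And>n. z n \<in> D" "z \<longlonglongrightarrow> u" unfolding closure_sequential by blast
    have un: "norm u = 1" using that G by (auto simp: determining_def)
    have zn: "norm (z n) = 1" "steiner (z n) h = h" for n
    proof -
      obtain i where "z n = d i" using z(1)[of n] from_nat_into_surj[OF D(1)] unfolding d_def by metis
      then show "norm (z n) = 1" "steiner (z n) h = h" using d_norm fixed_d by auto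
    qed
    have "uniform_limit UNIV (\<lambda>n. steiner (z n) h) (steiner u h) sequentially"
      by (rule steiner_uniform_limit[OF hcc hcc zn(1) un z(2)]) (simp add: uniform_limit_sequentially_iff)
    then have "(\<lambda>n. h y) \<longlonglongrightarrow> steiner u h y" for y
      using tendsto_uniform_limitI[where S=UNIV and x=y] by (auto simp: zn)
    then show ?thesis by (intro ext) (metis LIMSEQ_unique tendsto_const)
  qed
  then have "h = rearrangement f" using fixed_imp_eq_rearr[OF hk(1) G] by blast
  moreover obtain N where "\<forall>n\<ge>N. \<forall>x\<in>UNIV. dist ((g \<circ> k) n x) (h x) < \<epsilon>"
    using hk(3) \<epsilon> unfolding uniform_limit_sequentially_iff by blast
  ultimately show False using g(2)[of "k N"] by (auto simp: dist_real_def not_le[symmetric])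
qed

section \<open>Sequences of symmetrizations\<close>

lemma sup_norm_le: "(\<And>x. \<bar>h x\<bar> \<le> e) \<Longrightarrow> sup_norm h \<le> e"
  unfolding sup_norm_def by (rule cSUP_least) auto

lemma abs_le_sup_norm: "(\<And>x. \<bar>h x\<bar> \<le> B) \<Longrightarrow> \<bar>h x\<bar> \<le> sup_norm h"
  unfolding sup_norm_def by (intro cSUP_upper bdd_aboveI2[where M=B]) auto

lemma steiner_seq_cc:
  assumes "f \<in> cc" "\<And>i. norm (u i) = 1" shows "steiner_seq u n f \<in> cc"
  by (induction n) (simp_all add: assms steiner_cc)

lemma steiner_seq_in_class:
  assumes "f \<in> steiner_class f R" "0 \<le> R" "\<And>i. norm (u i) = 1"
  shows "steiner_seq u n f \<in> steiner_class f R"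
  by (induction n) (simp_all add: assms steiner_in_class)

lemma steiner_seq_cong:
  "(\<And>i. i < n \<Longrightarrow> u i = v i) \<Longrightarrow> steiner_seq u n f = steiner_seq v n f"
  by (induction n) simp_all

lemma steiner_seq_close:
  assumes "f \<in> cc" "g \<in> cc" "\<And>i. norm (u i) = 1" "\<And>x. \<bar>f x - g x\<bar> \<le> e"
  shows "\<bar>steiner_seq u n f x - steiner_seq u n g x\<bar> \<le> e"
proof (induction n arbitrary: x)
  case (Suc n)
  show ?case using steiner_close[OF steiner_seq_cc[OF assms(1,3)] steiner_seq_cc[OF assms(2,3)] assms(3) Suc] by simp
qed (use assms in simp)

lemma steiner_seq_uniform_limit:
  assumes "f \<in> cc" "\<And>k i. norm (v k i) = 1" "\<And>i. norm (u i) = 1" "\<And>i. (\<lambda>k. v k i) \<longlonglongrightarrow> u i"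
  shows "uniform_limit UNIV (\<lambda>k. steiner_seq (v k) n f) (steiner_seq u n f) sequentially"
proof (induction n)
  case (Suc n)
  have "uniform_limit UNIV (\<lambda>k. steiner (v k n) (steiner_seq (v k) n f)) (steiner (u n) (steiner_seq u n f)) sequentially"
    by (intro steiner_uniform_limit steiner_seq_cc assms Suc)
  then show ?case by simp
qed (simp add: uniform_limit_sequentially_iff)

text \<open>A sequence of directions is treated as a point of the countable product space. On
  sequences of unit vectors the iterated symmetrization depends continuously on this point, so
  composing with a continuous functional gives a Borel function.\<close>

lemma measurable_steiner_seq:
  fixes \<Phi> :: "(real^'d \<Rightarrow> real) \<Rightarrow> real" and X :: "'w \<Rightarrow> nat \<Rightarrow> real^'d"
  assumes f: "f \<in> steiner_class f R" "0 \<le> R"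
    and \<Phi>: "\<And>g h. (\<And>k. g k \<in> steiner_class f R) \<Longrightarrow> h \<in> steiner_class f R \<Longrightarrow>
       uniform_limit UNIV g h sequentially \<Longrightarrow> (\<lambda>k. \<Phi> (g k)) \<longlonglongrightarrow> \<Phi> h"
    and X: "\<And>i. (\<lambda>\<omega>. X \<omega> i) \<in> borel_measurable M" "\<And>\<omega> i. \<omega> \<in> space M \<Longrightarrow> norm (X \<omega> i) = 1"
  shows "(\<lambda>\<omega>. \<Phi> (steiner_seq (X \<omega>) n f)) \<in> borel_measurable M"
proof -
  let ?S = "{u :: nat \<Rightarrow> real^'d. \<forall>i. norm (u i) = 1}"
  have "continuous_on ?S (\<lambda>u. \<Phi> (steiner_seq u n f))"
  proof (rule continuous_on_sequentiallyI)
    fix v and u :: "nat \<Rightarrow> real^'d"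
    assume v: "\<forall>k. v k \<in> ?S" and u: "u \<in> ?S" and vu: "v \<longlonglongrightarrow> u"
    have "(\<lambda>k. v k i) \<longlonglongrightarrow> u i" for i
      using continuous_on_tendsto_compose[OF continuous_on_product_coordinates vu] by simp
    then show "(\<lambda>k. \<Phi> (steiner_seq (v k) n f)) \<longlonglongrightarrow> \<Phi> (steiner_seq u n f)"
      using u v by (intro \<Phi> steiner_seq_in_class f steiner_seq_uniform_limit steiner_class_cc[OF f(1)]) auto
  qed
  then have "(\<lambda>u. \<Phi> (steiner_seq u n f)) \<in> borel_measurable (restrict_space borel ?S)"
    by (rule borel_measurable_continuous_on_restrict)
  moreover have "X \<in> borel_measurable M" by (rule measurable_coordinatewise_then_product[OF X(1)])
  then have "X \<in> measurable M (restrict_space borel ?S)" using X(2) by (intro measurable_restrict_space2) auto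
  ultimately show ?thesis using measurable_compose by blast
qed

section \<open>Distance to the rearrangement along a sequence of symmetrizations\<close>

definition deviation :: "(real^'d \<Rightarrow> real) \<Rightarrow> (real^'d \<Rightarrow> real) \<Rightarrow> real" where
  "deviation f g = sup_norm (\<lambda>x. g x - rearrangement f x)"

lemma abs_le_deviation:
  assumes "f \<in> cc" "g \<in> cc" shows "\<bar>g x - rearrangement f x\<bar> \<le> deviation f g"
proof -
  obtain R where R: "0 \<le> R" "\<And>x. f x \<noteq> 0 \<Longrightarrow> norm x \<le> R" using cc_supportE[OF assms(1)] by blast
  have r: "rearrangement f \<in> cc" by (rule steiner_class_cc[OF rearr_in_steiner_class(1)[OF assms(1) R]])
  obtain A where A: "0 \<le> A" "\<And>x. g x \<le> A" using cc_bounded[OF assms(2)] by blast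
  obtain B where B: "0 \<le> B" "\<And>x. rearrangement f x \<le> B" using cc_bounded[OF r] by blast
  have "\<bar>g y - rearrangement f y\<bar> \<le> A + B" for y
    using A(2)[of y] B(2)[of y] cc_nonneg[OF assms(2), of y] cc_nonneg[OF r, of y] by linarith
  then show ?thesis unfolding deviation_def by (rule abs_le_sup_norm)
qed

lemma deviation_le: "(\<And>x. \<bar>g x - rearrangement f x\<bar> \<le> e) \<Longrightarrow> deviation f g \<le> e"
  unfolding deviation_def by (rule sup_norm_le)

lemma deviation_nonneg: "f \<in> cc \<Longrightarrow> g \<in> cc \<Longrightarrow> 0 \<le> deviation f g"
  using abs_le_deviation[of f g 0] by linarith

text \<open>Symmetrization is nonexpansive and fixes \<open>rearrangement f\<close>.\<close>

lemma deviation_steiner_le: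
  assumes "f \<in> cc" "g \<in> cc" "norm u = 1"
  shows "deviation f (steiner u g) \<le> deviation f g"
proof (rule deviation_le)
  fix x
  obtain R where R: "0 \<le> R" "\<And>x. f x \<noteq> 0 \<Longrightarrow> norm x \<le> R" using cc_supportE[OF assms(1)] by blast
  show "\<bar>steiner u g x - rearrangement f x\<bar> \<le> deviation f g"
    using steiner_close[OF assms(2) steiner_class_cc[OF rearr_in_steiner_class(1)[OF assms(1) R]] assms(3)
        abs_le_deviation[OF assms(1,2)]] rearr_in_steiner_class(2)[OF assms(1) R assms(3)] by simp
qed

lemma deviation_seq_decseq:
  assumes "f \<in> cc" "\<And>i. norm (u i) = 1"
  shows "decseq (\<lambda>n. deviation f (steiner_seq u n f))"
  by (rule decseq_SucI) (simp add: deviation_steiner_le steiner_seq_cc assms)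

lemma deviation_tendsto:
  assumes f: "f \<in> cc" and g: "\<And>k. g k \<in> cc" and h: "h \<in> cc" and lim: "uniform_limit UNIV g h sequentially"
  shows "(\<lambda>k. deviation f (g k)) \<longlonglongrightarrow> deviation f h"
proof (rule LIMSEQ_I)
  fix r :: real assume "0 < r"
  then have "0 < r / 2" by simp
  then obtain N where N: "\<And>n x. n \<ge> N \<Longrightarrow> dist (g n x) (h x) < r / 2"
    using lim unfolding uniform_limit_sequentially_iff by blast
  have "norm (deviation f (g n) - deviation f h) < r" if "n \<ge> N" for n
  proof -
    have d: "\<bar>g n x - h x\<bar> < r / 2" for x using N[OF that, of x] by (simp add: dist_real_def)
    have "deviation f (g n) \<le> deviation f h + r / 2"
    proof (rule deviation_le)
      show "\<bar>g n x - rearrangement f x\<bar> \<le> deviation f h + r / 2" for x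
        using d[of x] abs_le_deviation[OF f h, of x] by linarith
    qed
    moreover have "deviation f h \<le> deviation f (g n) + r / 2"
    proof (rule deviation_le)
      show "\<bar>h x - rearrangement f x\<bar> \<le> deviation f (g n) + r / 2" for x
        using d[of x] abs_le_deviation[OF f g, where x=x] by (smt (verit))
    qed
    ultimately show ?thesis using \<open>0 < r\<close> by (simp add: abs_less_iff)
  qed
  then show "\<exists>no. \<forall>n\<ge>no. norm (deviation f (g n) - deviation f h) < r" by blast
qed

lemma
  fixes f :: "real^'d \<Rightarrow> real" and X :: "'w \<Rightarrow> nat \<Rightarrow> real^'d"
  assumes f: "f \<in> cc"
    and X: "\<And>i. (\<lambda>\<omega>. X \<omega> i) \<in> borel_measurable M" "\<And>\<omega> i. \<omega> \<in> space M \<Longrightarrow> norm (X \<omega> i) = 1"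
  shows measurable_deviation_seq: "(\<lambda>\<omega>. deviation f (steiner_seq (X \<omega>) n f)) \<in> borel_measurable M"
    and measurable_moment_seq: "(\<lambda>\<omega>. moment (steiner_seq (X \<omega>) n f)) \<in> borel_measurable M"
proof -
  obtain R where R: "0 \<le> R" "\<And>x. f x \<noteq> 0 \<Longrightarrow> norm x \<le> R" using cc_supportE[OF f] by blast
  have fK: "f \<in> steiner_class f R" by (rule steiner_class_self[OF f R(2)])
  show "(\<lambda>\<omega>. deviation f (steiner_seq (X \<omega>) n f)) \<in> borel_measurable M"
    by (rule measurable_steiner_seq[OF fK R(1) _ X]) (auto intro: deviation_tendsto f steiner_class_cc)
  show "(\<lambda>\<omega>. moment (steiner_seq (X \<omega>) n f)) \<in> borel_measurable M"
  proof (rule measurable_steiner_seq[OF fK R(1) _ X])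
    fix g h assume "\<And>k. g k \<in> steiner_class f R" "h \<in> steiner_class f R" "uniform_limit UNIV g h sequentially"
    then show "(\<lambda>k. moment (g k)) \<longlonglongrightarrow> moment h"
      by (intro moment_tendsto[of g h R]) (auto intro: steiner_class_cc steiner_class_support)
  qed
qed

text \<open>Expresses convergence by countably many conditions on single terms, as needed for
  measurability and for null sets.\<close>

lemma decseq_LIMSEQ_0_iff:
  fixes d :: "nat \<Rightarrow> real"
  assumes "decseq d" "\<And>n. 0 \<le> d n"
  shows "d \<longlonglongrightarrow> 0 \<longleftrightarrow> (\<forall>k. \<exists>n. d n < 1 / real (Suc k))"
proof
  assume "d \<longlonglongrightarrow> 0"
  then show "\<forall>k. \<exists>n. d n < 1 / real (Suc k)"
    by (intro allI) (drule order_tendstoD(2)[where a="1 / real (Suc _)"], auto dest: eventually_happens)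
next
  assume *: "\<forall>k. \<exists>n. d n < 1 / real (Suc k)"
  show "d \<longlonglongrightarrow> 0"
  proof (rule LIMSEQ_I)
    fix r :: real assume "0 < r"
    then obtain k where "1 / real (Suc k) < r" using nat_approx_posE by blast
    moreover obtain n where "d n < 1 / real (Suc k)" using * by blast
    ultimately have "norm (d m - 0) < r" if "m \<ge> n" for m
      using decseqD[OF assms(1) that] assms(2)[of m] by simp
    then show "\<exists>no. \<forall>n\<ge>no. norm (d n - 0) < r" by blast
  qed
qed

text \<open>A maximum of 0 and finitely many cones of slope \<open>Suc l\<close> with prescribed
  heights and centres. The positive slope forces bounded support; rational heights and centres in a
  countable dense set leave only countably many such functions.\<close>

definition tent :: "nat \<Rightarrow> (real \<times> (real^'d)) list \<Rightarrow> real^'d \<Rightarrow> real" where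
  "tent l ps x = foldr (\<lambda>p m. max (fst p - real (Suc l) * norm (x - snd p)) m) ps 0"

lemma tent_le_iff: "tent l ps x \<le> c \<longleftrightarrow> 0 \<le> c \<and> (\<forall>p\<in>set ps. fst p - real (Suc l) * norm (x - snd p) \<le> c)"
  unfolding tent_def by (induction ps) auto

lemma tent_cc: "tent l ps \<in> cc"
proof -
  have "continuous_on UNIV (tent l ps)"
    unfolding tent_def by (induction ps) (auto intro!: continuous_intros)
  moreover have "0 \<le> tent l ps x" for x using tent_le_iff[of l ps x "tent l ps x"] by simp
  moreover have "norm x \<le> (\<Sum>p\<leftarrow>ps. \<bar>fst p\<bar> + norm (snd p))" if "tent l ps x \<noteq> 0" for x
  proof -
    have "\<not> tent l ps x \<le> 0" using that calculation(2)[of x] by simp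
    then obtain p where p: "p \<in> set ps" "0 < fst p - real (Suc l) * norm (x - snd p)"
      unfolding tent_le_iff by (auto simp: not_le)
    have "1 * norm (x - snd p) \<le> real (Suc l) * norm (x - snd p)" by (intro mult_right_mono) auto
    then have "norm x \<le> \<bar>fst p\<bar> + norm (snd p)" using p(2) norm_triangle_sub[of x "snd p"] by linarith
    also have "\<dots> \<le> (\<Sum>p\<leftarrow>ps. \<bar>fst p\<bar> + norm (snd p))"
      using p(1) by (intro member_le_sum_list) auto
    finally show ?thesis .
  qed
  ultimately show ?thesis by (auto simp: cc_def)
qed

lemma cc_countable_dense:
  obtains D where "countable D" "D \<subseteq> (cc :: (real^'d \<Rightarrow> real) set)"
    "\<And>f e. f \<in> cc \<Longrightarrow> 0 < e \<Longrightarrow> \<exists>g\<in>D. \<forall>x. \<bar>f x - g x\<bar> \<le> e"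
proof -
  obtain Q :: "(real^'d) set" where Q: "countable Q" "\<And>X. open X \<Longrightarrow> X \<noteq> {} \<Longrightarrow> \<exists>q\<in>Q. q \<in> X"
    using countable_dense_exists by blast
  define D where "D = (\<lambda>(l, ps). tent l ps) ` (UNIV \<times> lists (\<rat> \<times> Q))"
  have "countable D" unfolding D_def
    by (intro countable_image countable_SIGMA countable_lists countable_rat Q) auto
  moreover have "D \<subseteq> cc" by (auto simp: D_def tent_cc)
  moreover have "\<exists>g\<in>D. \<forall>x. \<bar>f x - g x\<bar> \<le> e" if f: "f \<in> cc" and e: "0 < e" for f :: "real^'d \<Rightarrow> real" and e
  proof -
    define e3 where "e3 = e / 3"
    have e3: "0 < e3" using e by (simp add: e3_def)
    obtain \<eta> where \<eta>: "0 < \<eta>" "osc \<eta> e3 f" using cc_osc[OF f e3] by blast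
    obtain B where B: "0 \<le> B" "\<And>x. f x \<le> B" using cc_bounded[OF f] by blast
    obtain R where R: "0 \<le> R" "\<And>x. f x \<noteq> 0 \<Longrightarrow> norm x \<le> R" using cc_supportE[OF f] by blast
    \<comment> \<open>The slope is so steep that a cone of height at most \<open>B\<close> is
      nonpositive at distance \<open>\<eta>\<close> from its centre; \<open>f\<close> is thus only
      compared at points where it varies by at most \<open>e3\<close>.\<close>
    obtain l where l: "B / \<eta> \<le> real l" using real_arch_simple by blast
    define L where "L = real (Suc l)"
    have L: "0 < L" "B \<le> L * \<eta>" using l \<eta>(1) by (auto simp: L_def field_simps intro: order_trans)
    \<comment> \<open>The mesh of the net of centres: within distance \<open>r\<close> a cone falls
      by at most \<open>e3\<close>.\<close>
    define r where "r = min \<eta> (e3 / L)"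
    have r: "0 < r" "r \<le> \<eta>" "L * r \<le> e3" using \<eta>(1) e3 L by (auto simp: r_def field_simps min_def)
    have "cball (0::real^'d) R \<subseteq> (\<Union>q\<in>Q. ball q r)"
    proof
      fix x :: "real^'d"
      obtain q where "q \<in> Q" "q \<in> ball x r" using Q(2)[of "ball x r"] r(1) by auto
      then show "x \<in> (\<Union>q\<in>Q. ball q r)" by (auto simp: dist_commute)
    qed
    then obtain Q' where Q': "Q' \<subseteq> Q" "finite Q'" "cball 0 R \<subseteq> (\<Union>q\<in>Q'. ball q r)"
      using compactE_image[OF compact_cball, of Q "\<lambda>q. ball q r" 0 R] by auto
    have "\<exists>a\<in>\<rat>. f q - e3 < a \<and> a < f q" for q
      using Rats_dense_in_real[of "f q - e3" "f q"] e3 by auto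
    then obtain a where a: "\<And>q. a q \<in> \<rat>" "\<And>q. f q - e3 < a q" "\<And>q. a q < f q" by metis
    obtain qs where qs: "set qs = Q'" using finite_list[OF Q'(2)] by blast
    define g where "g = tent l (map (\<lambda>q. (a q, q)) qs)"
    have "map (\<lambda>q. (a q, q)) qs \<in> lists (\<rat> \<times> Q)" using qs Q'(1) a(1) by auto
    then have "g \<in> D" unfolding D_def g_def by force
    moreover have "\<bar>f x - g x\<bar> \<le> e" for x
    proof -
      have "g x \<le> f x + e3"
        unfolding g_def tent_le_iff
      proof (intro conjI ballI)
        show "0 \<le> f x + e3" using cc_nonneg[OF f, of x] e3 by linarith
        fix p assume "p \<in> set (map (\<lambda>q. (a q, q)) qs)"
        then obtain q where p: "p = (a q, q)" by auto
        show "fst p - real (Suc l) * norm (x - snd p) \<le> f x + e3"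
        proof (cases "norm (q - x) \<le> \<eta>")
          case True
          then have "f q \<le> f x + e3" using \<eta>(2) by (auto simp: osc_def)
          moreover have "0 \<le> real (Suc l) * norm (x - q)" by simp
          ultimately show ?thesis using a(3)[of q] unfolding p fst_conv snd_conv by linarith
        next
          case False
          then have "L * \<eta> \<le> L * norm (x - q)" using L(1) by (simp add: norm_minus_commute)
          then have "a q - L * norm (x - q) \<le> 0" using L(2) B(2)[of q] a(3)[of q] by linarith
          then show ?thesis using cc_nonneg[OF f, of x] e3 by (simp add: p L_def)
        qed
      qed
      \<comment> \<open>One \<open>e3\<close> each for the oscillation of \<open>f\<close>, the
        rational height below \<open>f q\<close>, and the fall of the cone.\<close>
      moreover have "f x \<le> g x + 3 * e3"
      proof (cases "norm x \<le> R")
        case True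
        then obtain q where q: "q \<in> Q'" "norm (x - q) < r" using Q'(3) by (force simp: dist_norm norm_minus_commute)
        have "a q - L * norm (x - q) \<le> g x"
          using tent_le_iff[of l "map (\<lambda>q. (a q, q)) qs" x "g x"] q(1) qs by (auto simp: g_def L_def)
        moreover have "L * norm (x - q) \<le> L * r" using q(2) L(1) by simp
        moreover have "f x \<le> f q + e3" using q(2) r(2) \<eta>(2) by (auto simp: osc_def)
        ultimately show ?thesis using a(2)[of q] r(3) by linarith
      next
        case False
        then have "f x = 0" using R(2) by blast
        then show ?thesis using cc_nonneg[OF tent_cc, of l "map (\<lambda>q. (a q, q)) qs" x] e3 by (simp add: g_def)
      qed
      ultimately show ?thesis using e3 by (simp add: e3_def)
    qed
    ultimately show ?thesis by blast
  qed
  ultimately show ?thesis using that by blast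
qed

lemma deviation_LIMSEQ_dense:
  fixes u :: "nat \<Rightarrow> real^'d"
  assumes u: "\<And>i. norm (u i) = 1" and f: "f \<in> cc"
    and dense: "\<And>e. 0 < e \<Longrightarrow> \<exists>g\<in>D. \<forall>x. \<bar>f x - g x\<bar> \<le> e" and D: "D \<subseteq> cc"
    and lim: "\<And>g. g \<in> D \<Longrightarrow> (\<lambda>n. deviation g (steiner_seq u n g)) \<longlonglongrightarrow> 0"
  shows "(\<lambda>n. deviation f (steiner_seq u n f)) \<longlonglongrightarrow> 0"
proof (rule LIMSEQ_I)
  fix r :: real assume r: "0 < r"
  then obtain g where g: "g \<in> D" "\<And>x. \<bar>f x - g x\<bar> \<le> r / 4" using dense[of "r / 4"] by auto
  have gcc: "g \<in> cc" using g(1) D by blast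
  obtain N where N: "\<And>n. n \<ge> N \<Longrightarrow> norm (deviation g (steiner_seq u n g) - 0) < r / 4"
    using LIMSEQ_D[OF lim[OF g(1)], of "r / 4"] r by auto
  have "norm (deviation f (steiner_seq u n f) - 0) < r" if n: "n \<ge> N" for n
  proof -
    have "deviation f (steiner_seq u n f) \<le> 3 * (r / 4)"
    proof (rule deviation_le)
      fix x
      have "\<bar>steiner_seq u n g x - rearrangement g x\<bar> \<le> deviation g (steiner_seq u n g)"
        by (intro abs_le_deviation steiner_seq_cc gcc u)
      moreover have "\<bar>steiner_seq u n f x - steiner_seq u n g x\<bar> \<le> r / 4"
        by (rule steiner_seq_close[OF f gcc u g(2)])
      ultimately show "\<bar>steiner_seq u n f x - rearrangement f x\<bar> \<le> 3 * (r / 4)"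
        using rearr_close[OF f gcc g(2), of x] N[OF n]
        unfolding real_norm_def by linarith
    qed
    moreover have "0 \<le> deviation f (steiner_seq u n f)" by (intro deviation_nonneg steiner_seq_cc f u)
    ultimately show ?thesis using r by simp
  qed
  then show "\<exists>no. \<forall>n\<ge>no. norm (deviation f (steiner_seq u n f) - 0) < r" by blast
qed

section \<open>Random directions\<close>

lemma space_sphere_borel: "space sphere_borel = sphere 0 1"
  by (simp add: sphere_borel_def space_restrict_space)

lemma measurable_sphere_borel_iff:
  "X \<in> measurable M sphere_borel \<longleftrightarrow> X \<in> borel_measurable M \<and> (\<forall>\<omega>\<in>space M. norm (X \<omega>) = 1)"
  unfolding sphere_borel_def measurable_restrict_space2_iff by auto

text \<open>A chord of angle \<open>\<theta>\<close> has length
  \<open>2 * sin (\<theta> / 2) \<le> \<theta>\<close>. Geodesic balls thus lie in Euclidean balls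
  of the same radius, which are easier to handle.\<close>

lemma chord_le_geo_dist:
  assumes "norm u = 1" "norm v = 1" shows "norm (u - v) \<le> geo_dist u v"
proof -
  have "\<bar>u \<bullet> v\<bar> \<le> 1" using Cauchy_Schwarz_ineq2[of u v] assms by simp
  then have c: "cos (geo_dist u v) = u \<bullet> v" and "0 \<le> geo_dist u v" "geo_dist u v \<le> pi"
    unfolding geo_dist_def by (auto simp: abs_le_iff intro: cos_arccos arccos_lbound arccos_ubound)
  define t where "t = geo_dist u v / 2"
  have t: "0 \<le> t" "t \<le> pi / 2" using \<open>0 \<le> geo_dist u v\<close> \<open>geo_dist u v \<le> pi\<close> by (auto simp: t_def)
  have "(norm (u - v))\<^sup>2 = 2 - 2 * cos (2 * t)"
    using assms c unfolding power2_norm_eq_inner t_def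
    by (simp add: inner_diff inner_commute norm_eq_1)
  also have "\<dots> = (2 * sin t)\<^sup>2" unfolding cos_double_sin by (simp add: power_mult_distrib)
  finally have "(norm (u - v))\<^sup>2 = (2 * sin t)\<^sup>2" .
  moreover have "0 \<le> sin t" using t by (intro sin_ge_zero) auto
  ultimately have "norm (u - v) = 2 * sin t" by (intro power2_eq_imp_eq[of "norm (u - v)" "2 * sin t"]) simp_all
  also have "\<dots> \<le> geo_dist u v" using sin_x_le_x[OF t(1)] by (simp add: t_def)
  finally show ?thesis .
qed

locale random_directions = prob_space M for M :: "'w measure" +
  fixes U :: "nat \<Rightarrow> 'w \<Rightarrow> real^'d"
  assumes indep: "indep_vars (\<lambda>_. sphere_borel) U UNIV"
begin

definition hit_prob :: "nat \<Rightarrow> real^'d \<Rightarrow> real \<Rightarrow> real" where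
  "hit_prob n u \<rho> = prob {\<omega> \<in> space M. norm (U n \<omega> - u) < \<rho>}"

lemma U_measurable: "U i \<in> measurable M sphere_borel"
  using indep by (simp add: indep_vars_def2)

lemma U_borel [measurable]: "U i \<in> borel_measurable M"
  using U_measurable by (simp add: measurable_sphere_borel_iff)

lemma norm_U: "\<omega> \<in> space M \<Longrightarrow> norm (U i \<omega>) = 1"
  using U_measurable by (simp add: measurable_sphere_borel_iff)

lemma hit_prob_eq_distr: "hit_prob n u \<rho> = measure (distr M sphere_borel (U n)) {v \<in> sphere 0 1. norm (v - u) < \<rho>}"
proof -
  have "{v \<in> sphere 0 1. norm (v - u) < \<rho>} = {v \<in> space sphere_borel. norm (v - u) < \<rho>}"
    by (simp add: space_sphere_borel)
  also have "\<dots> \<in> sets sphere_borel"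
  proof -
    have "(\<lambda>v. v) \<in> borel_measurable sphere_borel"
      using measurable_ident[of sphere_borel] unfolding measurable_sphere_borel_iff id_def by blast
    then show ?thesis by measurable
  qed
  finally have "measure (distr M sphere_borel (U n)) {v \<in> sphere 0 1. norm (v - u) < \<rho>}
    = prob (U n -` {v \<in> sphere 0 1. norm (v - u) < \<rho>} \<inter> space M)"
    by (intro measure_distr U_measurable)
  also have "U n -` {v \<in> sphere 0 1. norm (v - u) < \<rho>} \<inter> space M = {\<omega> \<in> space M. norm (U n \<omega> - u) < \<rho>}"
    using norm_U by auto
  finally show ?thesis by (simp add: hit_prob_def)
qed

abbreviation symm :: "nat \<Rightarrow> (real^'d \<Rightarrow> real) \<Rightarrow> 'w \<Rightarrow> real^'d \<Rightarrow> real" where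
  "symm n f \<omega> \<equiv> steiner_seq (\<lambda>i. U i \<omega>) n f"

text \<open>The first \<open>n\<close> directions are independent of the next one. With the past
  frozen, a favourable \<open>u\<close> may be chosen depending on it, and the next direction hits
  its neighbourhood with probability at least \<open>p\<close>; integrating over the past gives the
  product.\<close>

lemma gain_prob_ge:
  assumes f: "f \<in> cc" and R: "0 \<le> R" "\<And>x. f x \<noteq> 0 \<Longrightarrow> norm x \<le> R" and "0 \<le> p"
    and gain: "\<And>g. g \<in> steiner_class f R \<Longrightarrow> \<epsilon> \<le> deviation f g \<Longrightarrow>
       \<exists>u. p \<le> hit_prob n u \<rho> \<and> (\<forall>v. norm v = 1 \<and> norm (v - u) < \<rho> \<longrightarrow> moment (steiner v g) \<le> moment g - \<delta>)"
  shows "p * prob {\<omega> \<in> space M. \<epsilon> \<le> deviation f (symm n f \<omega>)}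
    \<le> prob {\<omega> \<in> space M. moment (symm (Suc n) f \<omega>) \<le> moment (symm n f \<omega>) - \<delta>}"
proof -
  let ?S = "sphere_borel :: (real^'d) measure"
  let ?P = "PiM {..<n} (\<lambda>_. ?S)" and ?N = "PiM {n} (\<lambda>_. ?S)"
  define X where "X \<omega> = restrict (\<lambda>i. U i \<omega>) {..<n}" for \<omega>
  define Y where "Y \<omega> = restrict (\<lambda>i. U i \<omega>) {n}" for \<omega>
  \<comment> \<open>Pads the past and the present direction to an infinite sequence of unit vectors;
    the first \<open>n + 1\<close> symmetrizations do not see the entries after index
    \<open>n\<close>.\<close>
  define ext where "ext z i = (if i < n then fst z i else snd z n)" for z :: "(nat \<Rightarrow> real^'d) \<times> (nat \<Rightarrow> real^'d)" and i
  \<comment> \<open>A dummy present direction, for events that concern the past alone.\<close>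
  define e where "e = (\<lambda>i\<in>{n}. axis undefined 1 :: real^'d)"
  have e: "e \<in> space ?N" by (simp add: space_PiM space_sphere_borel e_def)
  have fK: "f \<in> steiner_class f R" by (rule steiner_class_self[OF f R(2)])

  have "indep_var ?P X ?N Y"
    unfolding X_def Y_def by (rule indep_var_restrict[OF indep]) auto
  then have XP: "X \<in> measurable M ?P" and YN: "Y \<in> measurable M ?N"
    and joint: "distr M ?P X \<Otimes>\<^sub>M distr M ?N Y = distr M (?P \<Otimes>\<^sub>M ?N) (\<lambda>\<omega>. (X \<omega>, Y \<omega>))"
    unfolding indep_var_distribution_eq by auto
  have coord_borel: "(\<lambda>y. y n) \<in> borel_measurable ?N"
    using measurable_component_singleton[of n "{n}" "\<lambda>_. ?S"] by (simp add: measurable_sphere_borel_iff)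

  have ext_borel: "(\<lambda>z. ext z i) \<in> borel_measurable (?P \<Otimes>\<^sub>M ?N)" for i
  proof (cases "i < n")
    case True
    then have "(\<lambda>z. fst z i) \<in> measurable (?P \<Otimes>\<^sub>M ?N) ?S"
      using measurable_compose[OF measurable_fst measurable_component_singleton[of i "{..<n}" "\<lambda>_. ?S"]] by simp
    then have "(\<lambda>z. fst z i) \<in> borel_measurable (?P \<Otimes>\<^sub>M ?N)" by (simp add: measurable_sphere_borel_iff)
    then show ?thesis using True by (simp add: ext_def)
  next
    case False
    have "(\<lambda>z. snd z n) \<in> borel_measurable (?P \<Otimes>\<^sub>M ?N)" using measurable_compose[OF measurable_snd coord_borel] .
    then show ?thesis using False by (simp add: ext_def)
  qed
  have ext_norm: "norm (ext z i) = 1" if "z \<in> space (?P \<Otimes>\<^sub>M ?N)" for z i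
    using that by (auto simp: ext_def space_pair_measure space_PiM space_sphere_borel PiE_iff)
  have ext_e_borel: "(\<lambda>x. ext (x, e) i) \<in> borel_measurable ?P" for i
    using measurable_compose[OF measurable_Pair2'[OF e] ext_borel[of i]] by (simp add: o_def)

  define A where "A = {x \<in> space ?P. \<epsilon> \<le> deviation f (steiner_seq (ext (x, e)) n f)}"
  define C where "C = {z \<in> space (?P \<Otimes>\<^sub>M ?N). moment (steiner_seq (ext z) (Suc n) f) \<le> moment (steiner_seq (ext z) n f) - \<delta>}"
  have ext_e_norm: "norm (ext (x, e) i) = 1" if "x \<in> space ?P" for x i
    using that e by (intro ext_norm) (simp add: space_pair_measure)
  have A: "A \<in> sets ?P"
    unfolding A_def using measurable_deviation_seq[OF f ext_e_borel ext_e_norm, where n=n] by measurable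
  have C: "C \<in> sets (?P \<Otimes>\<^sub>M ?N)"
    unfolding C_def
    using measurable_moment_seq[OF f ext_borel ext_norm, where n=n] measurable_moment_seq[OF f ext_borel ext_norm, where n="Suc n"]
    by measurable
  let ?Q = "distr M ?N Y"
  interpret Q: prob_space ?Q by (rule prob_space_distr[OF YN])

  \<comment> \<open>\<open>A\<close> is the event of being far from the rearrangement,
    \<open>C\<close> that of a gain at the next step; this bounds the section of \<open>C\<close>
    over each past \<open>x\<close>.\<close>
  have "ennreal p * indicator A x \<le> emeasure ?Q (Pair x -` C)" if x: "x \<in> space ?P" for x
  proof (cases "x \<in> A")
    case True
    let ?g = "steiner_seq (ext (x, e)) n f"
    have "?g \<in> steiner_class f R" by (rule steiner_seq_in_class[OF fK R(1) ext_e_norm[OF x]])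
    then obtain u where u: "p \<le> hit_prob n u \<rho>"
      "\<And>v. norm v = 1 \<Longrightarrow> norm (v - u) < \<rho> \<Longrightarrow> moment (steiner v ?g) \<le> moment ?g - \<delta>"
      using gain True unfolding A_def by blast
    have "{y \<in> space ?N. norm (y n - u) < \<rho>} \<subseteq> Pair x -` C"
    proof
      fix y assume y: "y \<in> {y \<in> space ?N. norm (y n - u) < \<rho>}"
      have "steiner_seq (ext (x, y)) n f = ?g" by (rule steiner_seq_cong) (simp add: ext_def)
      moreover have "ext (x, y) n = y n" by (simp add: ext_def)
      ultimately have "moment (steiner_seq (ext (x, y)) (Suc n) f) \<le> moment (steiner_seq (ext (x, y)) n f) - \<delta>"
        using u(2)[of "y n"] y by (simp add: space_PiM space_sphere_borel PiE_iff)
      then show "y \<in> Pair x -` C" using y x by (simp add: C_def space_pair_measure)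
    qed
    then have "measure ?Q {y \<in> space ?N. norm (y n - u) < \<rho>} \<le> measure ?Q (Pair x -` C)"
      using sets_Pair1[OF C] by (intro Q.finite_measure_mono) auto
    moreover have "measure ?Q {y \<in> space ?N. norm (y n - u) < \<rho>} = hit_prob n u \<rho>"
    proof -
      have "{y \<in> space ?N. norm (y n - u) < \<rho>} \<in> sets ?N" using coord_borel by measurable
      moreover have "Y -` {y \<in> space ?N. norm (y n - u) < \<rho>} \<inter> space M = {\<omega> \<in> space M. norm (U n \<omega> - u) < \<rho>}"
        using measurable_space[OF YN] by (auto simp: Y_def)
      ultimately show ?thesis by (simp add: measure_distr[OF YN] hit_prob_def)
    qed
    ultimately have "p \<le> measure ?Q (Pair x -` C)" using u(1) by simp
    then show ?thesis using True by (simp add: Q.emeasure_eq_measure)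
  qed simp
  then have "(\<integral>\<^sup>+x. ennreal p * indicator A x \<partial>distr M ?P X) \<le> (\<integral>\<^sup>+x. emeasure ?Q (Pair x -` C) \<partial>distr M ?P X)"
    by (intro nn_integral_mono) simp
  then have "ennreal p * emeasure (distr M ?P X) A \<le> emeasure (distr M ?P X \<Otimes>\<^sub>M ?Q) C"
    using A C by (subst Q.emeasure_pair_measure_alt) (simp_all add: nn_integral_cmult_indicator cong: sets_pair_measure_cong)
  moreover have "emeasure (distr M ?P X) A = prob {\<omega> \<in> space M. \<epsilon> \<le> deviation f (symm n f \<omega>)}"
  proof -
    have "X \<omega> \<in> A \<longleftrightarrow> \<epsilon> \<le> deviation f (symm n f \<omega>)" if "\<omega> \<in> space M" for \<omega>
    proof -
      have "steiner_seq (ext (X \<omega>, e)) n f = symm n f \<omega>" by (rule steiner_seq_cong) (simp add: ext_def X_def)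
      then show ?thesis using measurable_space[OF XP that] by (simp add: A_def)
    qed
    then have "X -` A \<inter> space M = {\<omega> \<in> space M. \<epsilon> \<le> deviation f (symm n f \<omega>)}" by auto
    then show ?thesis using A XP by (simp add: emeasure_distr emeasure_eq_measure)
  qed
  moreover have "emeasure (distr M ?P X \<Otimes>\<^sub>M ?Q) C = prob {\<omega> \<in> space M. moment (symm (Suc n) f \<omega>) \<le> moment (symm n f \<omega>) - \<delta>}"
  proof -
    have XU: "(\<lambda>\<omega>. (X \<omega>, Y \<omega>)) \<in> measurable M (?P \<Otimes>\<^sub>M ?N)" by (intro measurable_Pair XP YN)
    have "(X \<omega>, Y \<omega>) \<in> C \<longleftrightarrow> moment (symm (Suc n) f \<omega>) \<le> moment (symm n f \<omega>) - \<delta>" if "\<omega> \<in> space M" for \<omega>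
    proof -
      have "steiner_seq (ext (X \<omega>, Y \<omega>)) (Suc n) f = symm (Suc n) f \<omega>" "steiner_seq (ext (X \<omega>, Y \<omega>)) n f = symm n f \<omega>"
        by (rule steiner_seq_cong; auto simp: ext_def X_def Y_def less_Suc_eq)+
      then show ?thesis using measurable_space[OF XU that] by (simp only: C_def mem_Collect_eq simp_thms)
    qed
    then have "(\<lambda>\<omega>. (X \<omega>, Y \<omega>)) -` C \<inter> space M = {\<omega> \<in> space M. moment (symm (Suc n) f \<omega>) \<le> moment (symm n f \<omega>) - \<delta>}" by blast
    then show ?thesis unfolding joint using C XU by (simp add: emeasure_distr emeasure_eq_measure)
  qed
  ultimately show ?thesis using \<open>0 \<le> p\<close> by (simp add: ennreal_mult'[symmetric])
qed

lemma deviation_AE_LIMSEQ: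
  assumes f: "f \<in> cc" and G: "determining G"
    and hit: "\<And>T \<rho> C. finite T \<Longrightarrow> T \<noteq> {} \<Longrightarrow> T \<subseteq> G \<Longrightarrow> 0 < \<rho> \<Longrightarrow> \<exists>N. C < (\<Sum>n<N. Min ((\<lambda>u. hit_prob n u \<rho>) ` T))"
  shows "AE \<omega> in M. (\<lambda>n. deviation f (symm n f \<omega>)) \<longlonglongrightarrow> 0"
proof -
  obtain R where R: "0 \<le> R" "\<And>x. f x \<noteq> 0 \<Longrightarrow> norm x \<le> R" using cc_supportE[OF f] by blast
  have dev [measurable]: "(\<lambda>\<omega>. deviation f (symm n f \<omega>)) \<in> borel_measurable M"
    and mom [measurable]: "(\<lambda>\<omega>. moment (symm n f \<omega>)) \<in> borel_measurable M" for n
    by (rule measurable_deviation_seq measurable_moment_seq; use f norm_U in simp)+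
  have null: "prob {\<omega> \<in> space M. \<forall>n. \<epsilon> \<le> deviation f (symm n f \<omega>)} = 0" if \<epsilon>: "0 < \<epsilon>" for \<epsilon>
  proof (rule ccontr)
    let ?q = "prob {\<omega> \<in> space M. \<forall>n. \<epsilon> \<le> deviation f (symm n f \<omega>)}"
    assume "?q \<noteq> 0"
    then have q: "0 < ?q" using measure_nonneg[of M] by (simp add: less_le)
    \<comment> \<open>A deviation of at least \<open>\<epsilon>\<close> is a supremum; half of it is
      exceeded at an actual point, as the gap lemma requires.\<close>
    have "0 < \<epsilon> / 2" using \<epsilon> by simp
    from uniform_moment_gap[OF f R G this] obtain T \<delta> \<rho> where T: "finite T" "T \<noteq> {}" "T \<subseteq> G" and pos: "0 < \<delta>" "0 < \<rho>"
      and gap: "\<And>g x. g \<in> steiner_class f R \<Longrightarrow> \<epsilon> / 2 \<le> \<bar>g x - rearrangement f x\<bar> \<Longrightarrow>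
       \<exists>u\<in>T. \<forall>v. norm v = 1 \<and> norm (v - u) < \<rho> \<longrightarrow> moment (steiner v g) \<le> moment g - \<delta>"
      by blast
    define p where "p n = Min ((\<lambda>u. hit_prob n u \<rho>) ` T)" for n
    define C where "C n = {\<omega> \<in> space M. moment (symm (Suc n) f \<omega>) \<le> moment (symm n f \<omega>) - \<delta>}" for n
    have C [measurable]: "C n \<in> sets M" for n unfolding C_def by measurable
    have p0: "0 \<le> p n" for n using T by (simp add: p_def hit_prob_def)
    have "p n * ?q \<le> prob (C n)" for n
    proof -
      have "p n * prob {\<omega> \<in> space M. \<epsilon> \<le> deviation f (symm n f \<omega>)} \<le> prob (C n)"
        unfolding C_def
      proof (rule gain_prob_ge[OF f R p0])
        fix g assume g: "g \<in> steiner_class f R" "\<epsilon> \<le> deviation f g"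
        have "\<exists>x. \<epsilon> / 2 \<le> \<bar>g x - rearrangement f x\<bar>"
        proof (rule ccontr)
          assume "\<not> ?thesis"
          then have "deviation f g \<le> \<epsilon> / 2" by (intro deviation_le) (simp add: not_le less_imp_le)
          then show False using g(2) \<epsilon> by simp
        qed
        then obtain u where "u \<in> T" "\<forall>v. norm v = 1 \<and> norm (v - u) < \<rho> \<longrightarrow> moment (steiner v g) \<le> moment g - \<delta>"
          using gap[OF g(1)] by blast
        moreover have "p n \<le> hit_prob n u \<rho>" if "u \<in> T" for u using T that by (simp add: p_def)
        ultimately show "\<exists>u. p n \<le> hit_prob n u \<rho> \<and> (\<forall>v. norm v = 1 \<and> norm (v - u) < \<rho> \<longrightarrow> moment (steiner v g) \<le> moment g - \<delta>)"
          by blast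
      qed
      \<comment> \<open>Staying far forever is contained in being far at time \<open>n\<close>, so
        \<open>?q\<close> bounds all these probabilities from below.\<close>
      moreover have "?q \<le> prob {\<omega> \<in> space M. \<epsilon> \<le> deviation f (symm n f \<omega>)}"
        by (rule finite_measure_mono) auto
      ultimately show ?thesis using mult_left_mono[OF _ p0] by (meson order_trans)
    qed
    then have lower: "(\<Sum>n<N. p n) * ?q \<le> (\<Sum>n<N. prob (C n))" for N
      unfolding sum_distrib_right by (intro sum_mono)
    have "\<delta> * (\<Sum>n<N. prob (C n)) \<le> moment f" for N
    proof -
      \<comment> \<open>Telescoping: each step that belongs to \<open>C n\<close> lowers the moment
        by \<open>\<delta>\<close>, and no step raises it.\<close>
      have drop: "\<delta> * (\<Sum>n<N. indicator (C n) \<omega>) \<le> moment f - moment (symm N f \<omega>)" if \<omega>: "\<omega> \<in> space M" for \<omega>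
      proof (induction N)
        case (Suc N)
        have "symm N f \<omega> \<in> cc" using f norm_U[OF \<omega>] by (rule steiner_seq_cc)
        then have "moment (symm (Suc N) f \<omega>) \<le> moment (symm N f \<omega>)"
          using moment_steiner_le[OF _ norm_U[OF \<omega>]] by simp
        then have "\<delta> * indicator (C N) \<omega> \<le> moment (symm N f \<omega>) - moment (symm (Suc N) f \<omega>)"
          using \<omega> by (auto simp: C_def indicator_def)
        then show ?case using Suc by (simp add: distrib_left)
      qed simp
      have nonneg: "0 \<le> moment (symm N f \<omega>)" if "\<omega> \<in> space M" for \<omega>
        using f norm_U[OF that] by (intro moment_nonneg steiner_seq_cc)
      have le: "\<delta> * (\<Sum>n<N. indicator (C n) \<omega>) \<le> moment f" if "\<omega> \<in> space M" for \<omega>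
        using drop[OF that] nonneg[OF that] by linarith
      have "integrable M (\<lambda>\<omega>. \<Sum>n<N. indicator (C n) \<omega> :: real)"
        by (intro Bochner_Integration.integrable_sum integrable_real_indicator) (simp_all add: emeasure_eq_measure)
      then have "expectation (\<lambda>\<omega>. \<delta> * (\<Sum>n<N. indicator (C n) \<omega>)) \<le> expectation (\<lambda>\<omega>. moment f)"
        by (intro Bochner_Integration.integral_mono le) auto
      then show ?thesis by (simp add: prob_space Bochner_Integration.integral_sum emeasure_eq_measure)
    qed
    then have "\<delta> * ((\<Sum>n<N. p n) * ?q) \<le> moment f" for N
      using mult_left_mono[OF lower[of N], of \<delta>] pos(1) by (meson less_imp_le order_trans)
    then have "(\<Sum>n<N. p n) \<le> moment f / (\<delta> * ?q)" for N
      using pos(1) q by (simp add: pos_le_divide_eq mult_ac)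
    then show False using hit[OF T pos(2), of "moment f / (\<delta> * ?q)"] unfolding p_def by (meson not_le)
  qed
  have "AE \<omega> in M. \<not> (\<forall>n. 1 / real (Suc k) \<le> deviation f (symm n f \<omega>))" for k
    using null[of "1 / real (Suc k)"] by (subst AE_iff_measurable[OF _ refl]) (auto simp: emeasure_eq_measure)
  then have "AE \<omega> in M. \<forall>k. \<not> (\<forall>n. 1 / real (Suc k) \<le> deviation f (symm n f \<omega>))"
    by (simp add: AE_all_countable)
  then show ?thesis using AE_space
  proof eventually_elim
    case (elim \<omega>)
    then have u: "norm (U i \<omega>) = 1" for i by (intro norm_U)
    have "0 \<le> deviation f (symm n f \<omega>)" for n by (intro deviation_nonneg steiner_seq_cc f u)
    moreover have "decseq (\<lambda>n. deviation f (symm n f \<omega>))" by (intro deviation_seq_decseq f u)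
    ultimately show ?case using elim(1) by (simp add: decseq_LIMSEQ_0_iff not_le)
  qed
qed

text \<open>The quantifier over all \<open>f\<close> is uncountable, so the event is first shown to
  equal one with countably many conditions, over the dense family. This gives measurability and
  allows the almost sure statements to be combined.\<close>

lemma prob_convergence:
  assumes G: "determining G"
    and hit: "\<And>T \<rho> C. finite T \<Longrightarrow> T \<noteq> {} \<Longrightarrow> T \<subseteq> G \<Longrightarrow> 0 < \<rho> \<Longrightarrow> \<exists>N. C < (\<Sum>n<N. Min ((\<lambda>u. hit_prob n u \<rho>) ` T))"
  shows "prob {\<omega> \<in> space M. \<forall>f\<in>cc. (\<lambda>n. deviation f (symm n f \<omega>)) \<longlonglongrightarrow> 0} = 1"
proof -
  obtain D where D: "countable D" "D \<subseteq> (cc :: (real^'d \<Rightarrow> real) set)"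
    and dense: "\<And>f e. f \<in> cc \<Longrightarrow> 0 < e \<Longrightarrow> \<exists>g\<in>D. \<forall>x. \<bar>f x - g x\<bar> \<le> e"
    by (rule cc_countable_dense) blast
  have iff: "(\<lambda>n. deviation f (symm n f \<omega>)) \<longlonglongrightarrow> 0 \<longleftrightarrow> (\<forall>k. \<exists>n. deviation f (symm n f \<omega>) < 1 / real (Suc k))"
    if "f \<in> cc" "\<omega> \<in> space M" for f \<omega>
    using that norm_U by (intro decseq_LIMSEQ_0_iff deviation_seq_decseq deviation_nonneg steiner_seq_cc) auto
  have "{\<omega> \<in> space M. \<forall>f\<in>cc. (\<lambda>n. deviation f (symm n f \<omega>)) \<longlonglongrightarrow> 0}
      = {\<omega> \<in> space M. \<forall>f\<in>D. (\<lambda>n. deviation f (symm n f \<omega>)) \<longlonglongrightarrow> 0}"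
  proof (intro Collect_cong conj_cong refl iffI ballI)
    fix \<omega> and f :: "real^'d \<Rightarrow> real"
    assume \<omega>: "\<omega> \<in> space M" and lim: "\<forall>f\<in>D. (\<lambda>n. deviation f (symm n f \<omega>)) \<longlonglongrightarrow> 0" and f: "f \<in> cc"
    show "(\<lambda>n. deviation f (symm n f \<omega>)) \<longlonglongrightarrow> 0"
      by (rule deviation_LIMSEQ_dense[OF norm_U[OF \<omega>] f dense[OF f] D(2) bspec[OF lim]])
  qed (use D(2) in blast)
  also have "\<dots> = {\<omega> \<in> space M. \<forall>f\<in>D. \<forall>k. \<exists>n. deviation f (symm n f \<omega>) < 1 / real (Suc k)}"
    using iff D(2) by (intro Collect_cong conj_cong refl ball_cong) auto
  finally have eq: "{\<omega> \<in> space M. \<forall>f\<in>cc. (\<lambda>n. deviation f (symm n f \<omega>)) \<longlonglongrightarrow> 0}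
    = {\<omega> \<in> space M. \<forall>f\<in>D. \<forall>k. \<exists>n. deviation f (symm n f \<omega>) < 1 / real (Suc k)}" .
  have dev: "(\<lambda>\<omega>. deviation f (symm n f \<omega>)) \<in> borel_measurable M" if "f \<in> D" for f n
    using that D(2) norm_U by (intro measurable_deviation_seq) auto
  have "{\<omega> \<in> space M. \<exists>n. deviation f (symm n f \<omega>) < c} \<in> sets M" if "f \<in> D" for f c
    using dev[OF that] by measurable
  then have "{\<omega> \<in> space M. \<forall>k. \<exists>n. deviation f (symm n f \<omega>) < 1 / real (Suc k)} \<in> sets M" if "f \<in> D" for f
    using that by (intro sets.sets_Collect_countable_All) auto
  then have meas: "{\<omega> \<in> space M. \<forall>f\<in>D. \<forall>k. \<exists>n. deviation f (symm n f \<omega>) < 1 / real (Suc k)} \<in> sets M"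
    using D(1) by (intro sets.sets_Collect_countable_All')
  have "AE \<omega> in M. \<forall>f\<in>D. (\<lambda>n. deviation f (symm n f \<omega>)) \<longlonglongrightarrow> 0"
    using deviation_AE_LIMSEQ[OF _ G hit] D by (simp add: AE_ball_countable subset_iff)
  then have "AE \<omega> in M. \<forall>f\<in>D. \<forall>k. \<exists>n. deviation f (symm n f \<omega>) < 1 / real (Suc k)"
    using AE_space
  proof eventually_elim
    case (elim \<omega>)
    then show ?case using iff D(2) by blast
  qed
  then show ?thesis unfolding eq using meas by (subst prob_Collect_eq_1) auto
qed

end

theorem corollary2p3:
  fixes M :: "'w measure" and U :: "nat \<Rightarrow> 'w \<Rightarrow> real^'d"
  assumes "prob_space M"
    and "prob_space.indep_vars M (\<lambda>_. sphere_borel) U UNIV"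
  shows
    "((\<forall>\<rho>>0. \<forall>v. (\<forall>i. v i \<in> sphere 0 1) \<longrightarrow>
          (\<Sum>i. emeasure M {\<omega> \<in> space M. geo_dist (U i \<omega>) (v i) < \<rho>}) = \<infinity>)
       \<longrightarrow> measure M {\<omega> \<in> space M. \<forall>f\<in>Cc_nonneg.
             (\<lambda>n. sup_norm (\<lambda>x. steiner_seq (\<lambda>i. U i \<omega>) n f x - rearrangement f x))
               \<longlonglongrightarrow> 0} = 1)
     \<and> (\<forall>\<mu> G. sets \<mu> = sets sphere_borel \<and> prob_space \<mu>
          \<and> (\<forall>i. distr M sphere_borel (U i) = \<mu>)
          \<and> generating_directions G \<and> G \<subseteq> measure_support \<mu>
       \<longrightarrow> measure M {\<omega> \<in> space M. \<forall>f\<in>Cc_nonneg.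
             (\<lambda>n. sup_norm (\<lambda>x. steiner_seq (\<lambda>i. U i \<omega>) n f x - rearrangement f x))
               \<longlonglongrightarrow> 0} = 1)"
proof -
  interpret random_directions M U using assms by (simp add: random_directions_def random_directions_axioms_def)
  note convergence = prob_convergence[unfolded deviation_def Cc_nonneg_eq_cc[symmetric]]
  show ?thesis
  proof (intro conjI impI allI; (elim conjE)?)
    assume div: "\<forall>\<rho>>0. \<forall>v. (\<forall>i. v i \<in> sphere 0 1) \<longrightarrow>
          (\<Sum>i. emeasure M {\<omega> \<in> space M. geo_dist (U i \<omega>) (v i) < \<rho>}) = \<infinity>"
    show "measure M {\<omega> \<in> space M. \<forall>f\<in>Cc_nonneg.
             (\<lambda>n. sup_norm (\<lambda>x. steiner_seq (\<lambda>i. U i \<omega>) n f x - rearrangement f x)) \<longlonglongrightarrow> 0} = 1"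
    proof (rule convergence[OF determining_sphere])
      fix T :: "(real^'d) set" and \<rho> C :: real
      assume T: "finite T" "T \<noteq> {}" "T \<subseteq> sphere 0 1" and \<rho>: "0 < \<rho>"
      let ?p = "\<lambda>n. Min ((\<lambda>u. hit_prob n u \<rho>) ` T)"
      \<comment> \<open>The least likely element of \<open>T\<close> at each step forms the sequence
        to which the divergence hypothesis is applied.\<close>
      have "\<exists>v. v \<in> T \<and> ?p n = hit_prob n v \<rho>" for n
        using Min_in[of "(\<lambda>u. hit_prob n u \<rho>) ` T"] T(1,2) by (auto simp: image_iff)
      then obtain v where v: "\<And>n. v n \<in> T" "\<And>n. ?p n = hit_prob n (v n) \<rho>" by metis
      have v1: "norm (v n) = 1" for n using v(1)[of n] T(3) by auto
      have p0: "0 \<le> ?p n" for n unfolding v(2) by (simp add: hit_prob_def)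
      show "\<exists>N. C < (\<Sum>n<N. ?p n)"
      proof (rule ccontr)
        assume "\<not> ?thesis"
        then have bound: "(\<Sum>n<N. ?p n) \<le> C" for N by (simp add: not_less)
        have le: "emeasure M {\<omega> \<in> space M. geo_dist (U i \<omega>) (v i) < \<rho>} \<le> ennreal (?p i)" for i
        proof -
          have "{\<omega> \<in> space M. geo_dist (U i \<omega>) (v i) < \<rho>} \<subseteq> {\<omega> \<in> space M. norm (U i \<omega> - v i) < \<rho>}"
            using chord_le_geo_dist[OF norm_U v1] by (auto intro: le_less_trans)
          then have "emeasure M {\<omega> \<in> space M. geo_dist (U i \<omega>) (v i) < \<rho>} \<le> emeasure M {\<omega> \<in> space M. norm (U i \<omega> - v i) < \<rho>}"
            by (intro emeasure_mono) auto
          then show ?thesis unfolding v(2) by (simp add: hit_prob_def emeasure_eq_measure)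
        qed
        have "(\<Sum>i. emeasure M {\<omega> \<in> space M. geo_dist (U i \<omega>) (v i) < \<rho>}) \<le> (\<Sum>i. ennreal (?p i))"
          by (intro suminf_le le) auto
        also have "\<dots> = (SUP N. \<Sum>i<N. ennreal (?p i))" by (rule suminf_eq_SUP)
        also have "\<dots> \<le> ennreal C"
          using bound p0 by (intro SUP_least) (simp add: sum_ennreal ennreal_leI)
        finally have "(\<Sum>i. emeasure M {\<omega> \<in> space M. geo_dist (U i \<omega>) (v i) < \<rho>}) \<noteq> \<infinity>"
          by (auto simp: top_unique)
        moreover have "(\<Sum>i. emeasure M {\<omega> \<in> space M. geo_dist (U i \<omega>) (v i) < \<rho>}) = \<infinity>"
          using div \<rho> v1 by simp
        ultimately show False by contradiction
      qed
    qed
  next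
    fix \<mu> G
    assume \<mu>: "sets \<mu> = sets sphere_borel" "prob_space \<mu>" "\<forall>i. distr M sphere_borel (U i) = \<mu>"
      and G: "generating_directions G" "G \<subseteq> measure_support \<mu>"
    interpret \<mu>: prob_space \<mu> by fact
    show "measure M {\<omega> \<in> space M. \<forall>f\<in>Cc_nonneg.
             (\<lambda>n. sup_norm (\<lambda>x. steiner_seq (\<lambda>i. U i \<omega>) n f x - rearrangement f x)) \<longlonglongrightarrow> 0} = 1"
    proof (rule convergence[OF determining_generating[OF G(1)]])
      fix T :: "(real^'d) set" and \<rho> C :: real
      assume T: "finite T" "T \<noteq> {}" "T \<subseteq> G" and \<rho>: "0 < \<rho>"
      let ?B = "\<lambda>u. {v \<in> sphere 0 1. norm (v - u) < \<rho>}"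
      define c where "c = Min ((\<lambda>u. measure \<mu> (?B u)) ` T)"
      have p: "Min ((\<lambda>u. hit_prob n u \<rho>) ` T) = c" for n
        unfolding c_def hit_prob_eq_distr using \<mu>(3) by simp
      have space: "space \<mu> = sphere 0 1" using sets_eq_imp_space_eq[OF \<mu>(1)] by (simp add: space_sphere_borel)
      have "0 < measure \<mu> (?B u)" if u: "u \<in> T" for u
      proof (rule ccontr)
        assume "\<not> 0 < measure \<mu> (?B u)"
        then have 0: "measure \<mu> (?B u) = 0" using measure_nonneg[of \<mu> "?B u"] by linarith
        \<comment> \<open>If the neighbourhood of \<open>u\<close> were null, its complement
          \<open>K\<close> in the sphere would be closed of full measure and contain the support,
          but not \<open>u\<close>.\<close>
        define K where "K = sphere 0 1 - ball u \<rho>"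
        have "closed K" unfolding K_def by (intro closed_Diff) auto
        then have K: "K \<in> sets \<mu>"
          unfolding \<mu>(1) sphere_borel_def sets_restrict_space by (auto simp: K_def intro!: image_eqI[of _ _ K])
        have "sphere 0 1 - ?B u = K" by (auto simp: K_def dist_norm norm_minus_commute)
        then have "?B u = space \<mu> - K" by (auto simp: space)
        then have "measure \<mu> K = 1" using 0 \<mu>.prob_compl[OF K] by simp
        then have "emeasure \<mu> K = emeasure \<mu> (space \<mu>)"
          by (simp add: \<mu>.emeasure_eq_measure \<mu>.prob_space)
        then have "measure_support \<mu> \<subseteq> K" using K \<open>closed K\<close> by (auto simp: measure_support_def)
        then have "u \<in> K" using u T(3) G(2) by blast
        then show False using \<rho> by (simp add: K_def)
      qed
      then have "0 < c" unfolding c_def using T by simp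
      \<comment> \<open>Identical distribution makes every summand equal to \<open>c\<close>, so the
        partial sums are \<open>N * c\<close>.\<close>
      then obtain N where "C < real N * c" using reals_Archimedean3 by blast
      then show "\<exists>N. C < (\<Sum>n<N. Min ((\<lambda>u. hit_prob n u \<rho>) ` T))" by (auto simp: p)
    qed
  qed
qed

end
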